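(* Let $u$ be a positive integer, $p$ a prime number and $f(x)\in\mathbb{Z}[x]$ a monic polynomial such that $f(x^{p^u})$ is irreducible over $\mathbb{Q}$. Then: (1) If $f(x)$ is monogenic and $f(0)$ is squarefree, then the index of $f(x^{p^u})$ equals $p^s$ for some non-negative integer $s$. (2) $p$ does not divide the index of $f(x^{p^u})$ if and only if the polynomial $\frac{1}{p}\big(f(x^p)-f(x)^p\big)$ (which has integer coefficients) is coprime to $f(x)$ modulo $p$, i.e. their reductions modulo $p$ are coprime in $\mathbb{F}_p[x]$.
   Context: For a monic irreducible polynomial $g(x)\in\mathbb{Z}[x]$ with a root $\theta$ and $K=\mathbb{Q}(\theta)$ with ring of integers $\mathbb{Z}_K$, the index of $g$ is $[\mathbb{Z}_K:\mathbb{Z}[\theta]]$, and $g$ is monogenic if this index is $1$. *)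

theory Defs
  imports
    "HOL-Computational_Algebra.Computational_Algebra"
    "Berlekamp_Zassenhaus.Poly_Mod"
begin

definition rat_adjoin :: "complex \<Rightarrow> complex set" where
  "rat_adjoin \<theta> = {poly (map_poly of_rat a) \<theta> / poly (map_poly of_rat b) \<theta> | a b.
     poly (map_poly of_rat b) \<theta> \<noteq> 0}"

definition int_adjoin :: "complex \<Rightarrow> complex set" where
  "int_adjoin \<theta> = range (\<lambda>a :: int poly. poly (map_poly of_int a) \<theta>)"

definition integer_ring :: "complex set \<Rightarrow> complex set" where
  "integer_ring K = {\<alpha> \<in> K. algebraic_int \<alpha>}"

(* Number of cosets of B in A. The value would be 0 for infinitely many cosets, which does not
   happen below: for an algebraic integer \<theta>, int_adjoin \<theta> has finite index in the ring of integers. *)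
definition additive_index :: "complex set \<Rightarrow> complex set \<Rightarrow> nat" where
  "additive_index A B = card ((\<lambda>\<alpha>. (+) \<alpha> ` B) ` A)"

(* Meaningful for g monic and irreducible over the rationals. All complex roots of such a g
   give the same value: see poly_index_eq below. *)
definition poly_index :: "int poly \<Rightarrow> nat" where
  "poly_index g =
     (let \<theta> = (SOME \<theta> :: complex. poly (map_poly of_int g) \<theta> = 0)
      in additive_index (integer_ring (rat_adjoin \<theta>)) (int_adjoin \<theta>))"

definition monogenic :: "int poly \<Rightarrow> bool" where
  "monogenic g \<longleftrightarrow>
     lead_coeff g = 1 \<and> irreducible (map_poly of_int g :: rat poly) \<and> poly_index g = 1"

(* The embedding of rat_adjoin s into rat_adjoin t that sends s to t, as a relation. *)
definition conj_rel :: "complex \<Rightarrow> complex \<Rightarrow> complex rel" where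
  "conj_rel s t = {(poly (map_poly of_rat a) s / poly (map_poly of_rat b) s,
                    poly (map_poly of_rat a) t / poly (map_poly of_rat b) t) | a b.
     poly (map_poly of_rat b) s \<noteq> 0 \<and> poly (map_poly of_rat b) t \<noteq> 0}"

interpretation of_rat_poly: map_poly_comm_ring_hom "of_rat :: rat \<Rightarrow> complex" ..

lemma conj_rel_add:
  assumes "(x, y) \<in> conj_rel s t" "(x', y') \<in> conj_rel s t"
  shows "(x + x', y + y') \<in> conj_rel s t"
proof -
  from assms obtain a b a' b' where *:
    "x = poly (map_poly of_rat a) s / poly (map_poly of_rat b) s"
    "y = poly (map_poly of_rat a) t / poly (map_poly of_rat b) t"
    "x' = poly (map_poly of_rat a') s / poly (map_poly of_rat b') s"
    "y' = poly (map_poly of_rat a') t / poly (map_poly of_rat b') t"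
    and nz: "poly (map_poly of_rat b) s \<noteq> 0" "poly (map_poly of_rat b) t \<noteq> 0"
    "poly (map_poly of_rat b') s \<noteq> 0" "poly (map_poly of_rat b') t \<noteq> 0"
    unfolding conj_rel_def by blast
  show ?thesis
    unfolding conj_rel_def using * nz
    by (intro CollectI exI[of _ "a * b' + a' * b"] exI[of _ "b * b'"])
       (simp add: of_rat_poly.hom_add of_rat_poly.hom_mult add_frac_eq mult.commute)
qed

lemma conj_rel_mult:
  assumes "(x, y) \<in> conj_rel s t" "(x', y') \<in> conj_rel s t"
  shows "(x * x', y * y') \<in> conj_rel s t"
proof -
  from assms obtain a b a' b' where *:
    "x = poly (map_poly of_rat a) s / poly (map_poly of_rat b) s"
    "y = poly (map_poly of_rat a) t / poly (map_poly of_rat b) t"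
    "x' = poly (map_poly of_rat a') s / poly (map_poly of_rat b') s"
    "y' = poly (map_poly of_rat a') t / poly (map_poly of_rat b') t"
    and nz: "poly (map_poly of_rat b) s \<noteq> 0" "poly (map_poly of_rat b) t \<noteq> 0"
    "poly (map_poly of_rat b') s \<noteq> 0" "poly (map_poly of_rat b') t \<noteq> 0"
    unfolding conj_rel_def by blast
  show ?thesis
    unfolding conj_rel_def using * nz
    by (intro CollectI exI[of _ "a * a'"] exI[of _ "b * b'"])
       (simp add: of_rat_poly.hom_mult)
qed

lemma conj_rel_poly: "(poly (map_poly of_rat a) s, poly (map_poly of_rat a) t) \<in> conj_rel s t"
  unfolding conj_rel_def by (intro CollectI exI[of _ a] exI[of _ 1]) simp

lemma conj_rel_int_poly:
  fixes a :: "int poly"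
  shows "(poly (map_poly of_int a) s, poly (map_poly of_int a) t) \<in> conj_rel s t"
proof -
  have "map_poly (of_rat :: rat \<Rightarrow> complex) (map_poly of_int a) = map_poly of_int a"
    by (subst map_poly_map_poly) (auto simp: o_def)
  with conj_rel_poly[of "map_poly of_int a" s t] show ?thesis by simp
qed

lemma conj_rel_const: "(of_int c, of_int c) \<in> conj_rel s t"
  using conj_rel_int_poly[of "[:c:]" s t] by (simp add: of_int_hom.map_poly_pCons_hom)

lemma conj_rel_poly_image:
  fixes P :: "int poly"
  assumes "(x, y) \<in> conj_rel s t"
  shows "(poly (map_poly of_int P) x, poly (map_poly of_int P) y) \<in> conj_rel s t"
proof (induction P)
  case 0
  show ?case using conj_rel_const[of 0 s t] by simp
next
  case (pCons c P)
  show ?case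
    using conj_rel_add[OF conj_rel_const[of c s t] conj_rel_mult[OF assms pCons.IH]]
    by (simp add: of_int_hom.map_poly_pCons_hom)
qed

lemma conj_rel_converse: "(conj_rel s t)\<inverse> = conj_rel t s"
  unfolding conj_rel_def by auto

lemma rat_poly_root_transfer:
  fixes G q :: "rat poly" and s t :: complex
  assumes irr: "irreducible G" and "poly (map_poly of_rat G) s = 0" "poly (map_poly of_rat G) t = 0"
    and qs: "poly (map_poly of_rat q) s = 0"
  shows "poly (map_poly of_rat q) t = 0"
proof (cases "G dvd q")
  case True
  then obtain r where "q = G * r" by (elim dvdE)
  then show ?thesis using assms by (simp add: of_rat_poly.hom_mult)
next
  case False
  from irr have "prime_elem G" by (rule irreducible_imp_prime_elem)
  then have "algebraic_semidom_class.coprime G q" using False by (rule prime_elem_imp_coprime)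
  then have "gcd G q = 1" by simp
  then obtain u v where "u * G + v * q = 1"
    using bezout_coefficients_fst_snd[of G q] by metis
  then have "poly (map_poly of_rat (u * G + v * q)) s = (1 :: complex)" by simp
  then show ?thesis
    using assms by (simp add: of_rat_poly.hom_add of_rat_poly.hom_mult)
qed

locale conjugate_roots =
  fixes s t :: complex
  assumes zero_iff: "\<And>q :: rat poly.
    poly (map_poly of_rat q) s = 0 \<longleftrightarrow> poly (map_poly of_rat q) t = 0"
begin

lemma conj_rel_zero:
  assumes "(0, y) \<in> conj_rel s t" shows "y = 0"
proof -
  from assms obtain a b where *: "0 = poly (map_poly of_rat a) s / poly (map_poly of_rat b) s"
    and y: "y = poly (map_poly of_rat a) t / poly (map_poly of_rat b) t"
    and "poly (map_poly of_rat b) s \<noteq> 0"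
    unfolding conj_rel_def by blast
  then have "poly (map_poly of_rat a) s = 0" by (metis divide_eq_0_iff)
  then have "poly (map_poly of_rat a) t = 0" by (rule zero_iff[THEN iffD1])
  then show ?thesis unfolding y by (simp only: div_0)
qed

lemma conj_rel_functional:
  assumes "(x, y) \<in> conj_rel s t" "(x, z) \<in> conj_rel s t" shows "y = z"
proof -
  have "(x + of_int (-1) * x, y + of_int (-1) * z) \<in> conj_rel s t"
    by (rule conj_rel_add[OF assms(1) conj_rel_mult[OF conj_rel_const assms(2)]])
  then have "(0, y - z) \<in> conj_rel s t" by simp
  then have "y - z = 0" by (rule conj_rel_zero)
  then show ?thesis by simp
qed

lemma rat_adjoin_conj:
  assumes "x \<in> rat_adjoin s" obtains y where "(x, y) \<in> conj_rel s t" "y \<in> rat_adjoin t"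
proof -
  from assms obtain a b where x: "x = poly (map_poly of_rat a) s / poly (map_poly of_rat b) s"
    and s0: "poly (map_poly of_rat b) s \<noteq> 0"
    unfolding rat_adjoin_def by blast
  from s0 have t0: "poly (map_poly of_rat b) t \<noteq> 0" by (simp only: zero_iff not_False_eq_True)
  show thesis
  proof (rule that)
    show "(x, poly (map_poly of_rat a) t / poly (map_poly of_rat b) t) \<in> conj_rel s t"
      unfolding conj_rel_def x using s0 t0 by blast
    show "poly (map_poly of_rat a) t / poly (map_poly of_rat b) t \<in> rat_adjoin t"
      unfolding rat_adjoin_def using t0 by blast
  qed
qed

lemma integer_ring_conj:
  assumes "x \<in> integer_ring (rat_adjoin s)"
  obtains y where "(x, y) \<in> conj_rel s t" "y \<in> integer_ring (rat_adjoin t)"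
proof -
  from assms have x: "x \<in> rat_adjoin s" and "algebraic_int x"
    unfolding integer_ring_def by auto
  then obtain P where P: "poly (map_poly of_int P) x = 0" "lead_coeff P = 1"
    by (auto simp: algebraic_int_altdef_ipoly)
  from x obtain y where y: "(x, y) \<in> conj_rel s t" "y \<in> rat_adjoin t"
    by (rule rat_adjoin_conj)
  have "poly (map_poly of_int P) y = 0"
    using conj_rel_poly_image[OF y(1), of P] unfolding P(1) by (rule conj_rel_zero)
  then have "algebraic_int y" using P(2) by (auto simp: algebraic_int_altdef_ipoly)
  with y that show thesis unfolding integer_ring_def by auto
qed

lemma coset_image:
  assumes "(x, y) \<in> conj_rel s t"
  shows "(conj_rel s t) `` ((+) x ` int_adjoin s) = (+) y ` int_adjoin t"
proof -
  have 1: "(x + poly (map_poly of_int a) s, y + poly (map_poly of_int a) t) \<in> conj_rel s t"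
    for a :: "int poly"
    by (rule conj_rel_add[OF assms conj_rel_int_poly])
  show ?thesis
  proof (intro equalityI subsetI)
    fix z assume "z \<in> (conj_rel s t) `` ((+) x ` int_adjoin s)"
    then obtain a :: "int poly" where "(x + poly (map_poly of_int a) s, z) \<in> conj_rel s t"
      unfolding int_adjoin_def by auto
    from conj_rel_functional[OF this 1] show "z \<in> (+) y ` int_adjoin t"
      unfolding int_adjoin_def by auto
  next
    fix z assume "z \<in> (+) y ` int_adjoin t"
    then obtain a :: "int poly" where "z = y + poly (map_poly of_int a) t"
      unfolding int_adjoin_def by auto
    with 1[of a] show "z \<in> (conj_rel s t) `` ((+) x ` int_adjoin s)"
      unfolding int_adjoin_def by auto
  qed
qed

end

lemma additive_index_conjugate:
  assumes "conjugate_roots s t"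
  shows "additive_index (integer_ring (rat_adjoin s)) (int_adjoin s) =
    additive_index (integer_ring (rat_adjoin t)) (int_adjoin t)"
proof -
  have "conjugate_roots t s" using assms unfolding conjugate_roots_def by auto
  interpret st: conjugate_roots s t by fact
  interpret ts: conjugate_roots t s by fact
  let ?C = "\<lambda>u. (\<lambda>\<alpha>. (+) \<alpha> ` int_adjoin u) ` integer_ring (rat_adjoin u)"
  have conv: "(y, x) \<in> conj_rel t s" if "(x, y) \<in> conj_rel s t" for x y s t
    using that conj_rel_converse[of s t] by blast
  have "bij_betw (\<lambda>A. conj_rel s t `` A) (?C s) (?C t)"
  proof (rule bij_betw_byWitness[where f' = "\<lambda>A. conj_rel t s `` A"])
    show "\<forall>A\<in>?C s. conj_rel t s `` (conj_rel s t `` A) = A"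
    proof
      fix A assume "A \<in> ?C s"
      then obtain x where x: "x \<in> integer_ring (rat_adjoin s)" "A = (+) x ` int_adjoin s" by blast
      from st.integer_ring_conj[OF x(1)] obtain y where "(x, y) \<in> conj_rel s t" .
      from st.coset_image[OF this] ts.coset_image[OF conv[OF this]]
      show "conj_rel t s `` (conj_rel s t `` A) = A"
        unfolding x(2) by simp
    qed
    show "\<forall>A\<in>?C t. conj_rel s t `` (conj_rel t s `` A) = A"
    proof
      fix A assume "A \<in> ?C t"
      then obtain x where x: "x \<in> integer_ring (rat_adjoin t)" "A = (+) x ` int_adjoin t" by blast
      from ts.integer_ring_conj[OF x(1)] obtain y where "(x, y) \<in> conj_rel t s" .
      from ts.coset_image[OF this] st.coset_image[OF conv[OF this]]
      show "conj_rel s t `` (conj_rel t s `` A) = A"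
        unfolding x(2) by simp
    qed
    show "(\<lambda>A. conj_rel s t `` A) ` ?C s \<subseteq> ?C t"
    proof clarify
      fix x assume "x \<in> integer_ring (rat_adjoin s)"
      from st.integer_ring_conj[OF this]
      obtain y where y: "(x, y) \<in> conj_rel s t" "y \<in> integer_ring (rat_adjoin t)" .
      show "conj_rel s t `` ((+) x ` int_adjoin s) \<in> ?C t"
        unfolding st.coset_image[OF y(1)] using y(2) by (rule imageI)
    qed
    show "(\<lambda>A. conj_rel t s `` A) ` ?C t \<subseteq> ?C s"
    proof clarify
      fix x assume "x \<in> integer_ring (rat_adjoin t)"
      from ts.integer_ring_conj[OF this]
      obtain y where y: "(x, y) \<in> conj_rel t s" "y \<in> integer_ring (rat_adjoin s)" .
      show "conj_rel t s `` ((+) x ` int_adjoin t) \<in> ?C s"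
        unfolding ts.coset_image[OF y(1)] using y(2) by (rule imageI)
    qed
  qed
  then show ?thesis unfolding additive_index_def by (rule bij_betw_same_card)
qed

lemma poly_index_eq:
  fixes \<theta> :: complex
  assumes irr: "irreducible (map_poly of_int g :: rat poly)"
    and root: "poly (map_poly of_int g) \<theta> = 0"
  shows "poly_index g = additive_index (integer_ring (rat_adjoin \<theta>)) (int_adjoin \<theta>)"
proof -
  define s :: complex where "s = (SOME \<theta>. poly (map_poly of_int g) \<theta> = 0)"
  have s: "poly (map_poly of_int g) s = 0"
    unfolding s_def by (rule someI) (rule root)
  have *: "map_poly (of_rat :: rat \<Rightarrow> complex) (map_poly of_int g) = map_poly of_int g"
    by (subst map_poly_map_poly) (auto simp: o_def)
  have "conjugate_roots s \<theta>"
  proof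
    fix q :: "rat poly"
    show "poly (map_poly of_rat q) s = 0 \<longleftrightarrow> poly (map_poly of_rat q) \<theta> = 0"
      using rat_poly_root_transfer[OF irr, of s \<theta> q] rat_poly_root_transfer[OF irr, of \<theta> s q]
        s root unfolding * by blast
  qed
  from additive_index_conjugate[OF this] show ?thesis
    unfolding poly_index_def s_def[symmetric] Let_def .
qed

end

theory Submission
  imports Defs "Jordan_Normal_Form.Char_Poly" "HOL-Algebra.Sylow"
    "HOL-Algebra.Multiplicative_Group"
begin

hide_const (open) Module.smult UnivPoly.up_ring.monom UnivPoly.up_ring.coeff

text \<open>Write \<open>F(x) = f(x\<^sup>N)\<close> with \<open>N = p\<^sup>u\<close>, let \<open>\<theta>\<close> be a root of \<open>F\<close> and
  \<open>\<eta> = \<theta>\<^sup>N\<close>.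

  (1) An integer \<open>x\<close> of the field is \<open>\<Sum>i<N. \<theta>\<^sup>i c\<^sub>i(\<eta>)\<close> with rational \<open>c\<^sub>i\<close>. Averaging over the
  conjugates \<open>\<zeta>\<^sup>j \<theta>\<close> shows that each \<open>\<theta>\<^sup>i X\<^sub>i\<close> with \<open>X\<^sub>i = N c\<^sub>i(\<eta>)\<close> is integral. Since \<open>f\<close> is monogenic,
  \<open>\<eta> X\<^sub>i\<close> lies in \<open>\<int>[\<eta>]\<close>, and its \<open>N\<close>-th power \<open>\<eta>\<^bsup>N-i\<^esup> (\<theta>\<^sup>i X\<^sub>i)\<^sup>N\<close> is divisible by \<open>\<eta>\<close> there. As
  \<open>\<int>[\<eta>]/(\<eta>) = \<int>/(f(0))\<close> is reduced, \<open>X\<^sub>i\<close> lies in \<open>\<int>[\<eta>]\<close>. So \<open>N\<close> annihilates the finite quotient of the ring of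
  integers by \<open>\<int>[\<theta>]\<close>, whose order is therefore a power of \<open>p\<close>.

  (2) Modulo \<open>p\<^sup>2\<close> one has \<open>F = f\<^sup>N + p h\<^bsup>N/p\<^esup>\<close>, and Dedekind's criterion for a polynomial
  \<open>f\<^sup>k + p m\<close> with \<open>k \<ge> 2\<close> reads: \<open>p\<close> does not divide the index iff \<open>m\<close> and \<open>f\<close> are coprime modulo
  \<open>p\<close>.\<close>

section \<open>Algebraic integers\<close>

abbreviation ev :: "int poly \<Rightarrow> complex \<Rightarrow> complex" where
  "ev a z \<equiv> poly (map_poly of_int a) z"

abbreviation evq :: "rat poly \<Rightarrow> complex \<Rightarrow> complex" where
  "evq a z \<equiv> poly (map_poly of_rat a) z"

lemma of_rat_of_int_poly: "map_poly of_rat (map_poly of_int a :: rat poly) = (map_poly of_int a :: complex poly)"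
  by (subst map_poly_map_poly) (auto simp: o_def)

lemma ev_pcompose: "ev (a \<circ>\<^sub>p b) z = ev a (ev b z)"
  by (simp add: of_int_hom.map_poly_pcompose poly_pcompose)

lemma ev_pCons: "ev (pCons c a) z = of_int c + z * ev a z"
  by (simp add: of_int_hom.map_poly_pCons_hom)

lemmas ev_simps = of_int_poly_hom.hom_add of_int_poly_hom.hom_mult of_int_poly_hom.hom_power
  of_int_poly_hom.hom_minus of_int_poly_hom.hom_uminus ev_pCons ev_pcompose

section \<open>Finitely generated additive groups as a test for integrality\<close>

definition zspan :: "complex set \<Rightarrow> complex set" where
  "zspan S = range (\<lambda>c :: complex \<Rightarrow> int. \<Sum>s\<in>S. of_int (c s) * s)"

lemma zspan_0: "0 \<in> zspan S"
  unfolding zspan_def by (rule range_eqI[of _ _ "\<lambda>_. 0"]) simp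

lemma zspan_add: "x \<in> zspan S \<Longrightarrow> y \<in> zspan S \<Longrightarrow> x + y \<in> zspan S"
  unfolding zspan_def
proof clarify
  fix c d :: "complex \<Rightarrow> int"
  show "(\<Sum>s\<in>S. of_int (c s) * s) + (\<Sum>s\<in>S. of_int (d s) * s) \<in> range (\<lambda>c. \<Sum>s\<in>S. of_int (c s) * s)"
    by (rule range_eqI[of _ _ "\<lambda>s. c s + d s"]) (simp add: sum.distrib algebra_simps)
qed

lemma zspan_scale: "x \<in> zspan S \<Longrightarrow> of_int k * x \<in> zspan S"
  unfolding zspan_def
proof clarify
  fix c :: "complex \<Rightarrow> int"
  show "of_int k * (\<Sum>s\<in>S. of_int (c s) * s) \<in> range (\<lambda>c. \<Sum>s\<in>S. of_int (c s) * s)"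
    by (rule range_eqI[of _ _ "\<lambda>s. k * c s"]) (simp add: sum_distrib_left algebra_simps)
qed

lemma zspan_sum: "(\<And>i. i \<in> I \<Longrightarrow> f i \<in> zspan S) \<Longrightarrow> sum f I \<in> zspan S"
  by (induction I rule: infinite_finite_induct) (auto intro: zspan_0 zspan_add)

lemma zspan_base: "finite S \<Longrightarrow> s \<in> S \<Longrightarrow> s \<in> zspan S"
  unfolding zspan_def
  by (rule range_eqI[of _ _ "\<lambda>t. if t = s then 1 else 0"]) (simp add: if_distrib if_distribR cong: if_cong)

lemma zspan_mult_closed:
  assumes "\<And>s. s \<in> S \<Longrightarrow> x * s \<in> zspan S" and "y \<in> zspan S"
  shows "x * y \<in> zspan S"
proof -
  from assms(2) obtain c where y: "y = (\<Sum>s\<in>S. of_int (c s) * s)"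
    unfolding zspan_def by blast
  have "x * y = (\<Sum>s\<in>S. of_int (c s) * (x * s))"
    unfolding y by (simp add: sum_distrib_left algebra_simps)
  then show ?thesis using assms(1) by (auto intro: zspan_sum zspan_scale)
qed

lemma ev_mult_closed:
  assumes "\<And>y. y \<in> zspan S \<Longrightarrow> x * y \<in> zspan S" and "y \<in> zspan S"
  shows "ev a x * y \<in> zspan S"
proof (induction a)
  case 0
  show ?case by (simp add: zspan_0)
next
  case (pCons c a)
  show ?case
    using zspan_add[OF zspan_scale[OF assms(2), of c] assms(1)[OF pCons.IH]]
    by (simp add: ev_pCons algebra_simps)
qed

text \<open>\<open>x\<close> is an eigenvalue of the integer matrix of multiplication by \<open>x\<close> on the generators \<open>S\<close>.\<close>
lemma algebraic_int_if_zspan_closed: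
  assumes fin: "finite S" and s0: "s0 \<in> S" "s0 \<noteq> 0"
    and closed: "\<And>s. s \<in> S \<Longrightarrow> x * s \<in> zspan S"
  shows "algebraic_int x"
proof -
  define n where "n = card S"
  obtain v where v: "bij_betw v {..<n} S"
    using ex_bij_betw_nat_finite[OF fin] unfolding n_def atLeast0LessThan by blast
  have "\<exists>c :: complex \<Rightarrow> int. x * s = (\<Sum>t\<in>S. of_int (c t) * t)" if "s \<in> S" for s
    using closed[OF that] unfolding zspan_def by blast
  then obtain c :: "complex \<Rightarrow> complex \<Rightarrow> int"
    where c: "\<And>s. s \<in> S \<Longrightarrow> x * s = (\<Sum>t\<in>S. of_int (c s t) * t)" by metis
  define A where "A = mat n n (\<lambda>(i, j). c (v i) (v j))"
  have A: "A \<in> carrier_mat n n" unfolding A_def by simp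
  let ?A = "map_mat complex_of_int A"
  have A': "?A \<in> carrier_mat n n" using A by simp
  define w where "w = vec n v"
  have w: "w \<in> carrier_vec n" unfolding w_def by simp
  have "?A *\<^sub>v w = x \<cdot>\<^sub>v w"
  proof (rule eq_vecI)
    show "dim_vec (?A *\<^sub>v w) = dim_vec (x \<cdot>\<^sub>v w)" using A w by simp
    fix i assume "i < dim_vec (x \<cdot>\<^sub>v w)"
    then have i: "i < n" using w by simp
    then have "v i \<in> S" using v by (auto simp: bij_betw_def)
    from c[OF this] have "x * v i = (\<Sum>j<n. of_int (c (v i) (v j)) * v j)"
      using sum.reindex_bij_betw[OF v, of "\<lambda>t. of_int (c (v i) t) * t"] by simp
    then show "(?A *\<^sub>v w) $ i = (x \<cdot>\<^sub>v w) $ i"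
      using i by (simp add: A_def w_def scalar_prod_def atLeast0LessThan)
  qed
  moreover have "w \<noteq> 0\<^sub>v n"
  proof
    assume "w = 0\<^sub>v n"
    moreover obtain i where "i < n" "v i = s0" using s0(1) v by (auto simp: bij_betw_def)
    ultimately have "w $ i = 0" by simp
    then show False using \<open>i < n\<close> \<open>v i = s0\<close> s0(2) by (simp add: w_def)
  qed
  ultimately have "eigenvector ?A w x"
    using A' w by (auto simp: eigenvector_def)
  then have "eigenvalue ?A x" unfolding eigenvalue_def by blast
  then have "poly (char_poly ?A) x = 0" using eigenvalue_root_char_poly[OF A'] by simp
  then have "ev (char_poly A) x = 0" by (simp add: of_int_hom.char_poly_hom[OF A])
  moreover have "lead_coeff (char_poly A) = 1" using degree_monic_char_poly[OF A] by simp
  ultimately show ?thesis unfolding algebraic_int_altdef_ipoly by blast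
qed

lemma algebraic_intE:
  assumes "algebraic_int x"
  obtains P where "ev P x = 0" "lead_coeff P = 1" "degree P > 0"
proof -
  from assms obtain P where P: "ev P x = 0" "lead_coeff P = 1"
    by (auto simp: algebraic_int_altdef_ipoly)
  moreover have "degree P > 0"
  proof (rule ccontr)
    assume "\<not> degree P > 0"
    then obtain c where "P = [:c:]" by (metis degree_eq_zeroE gr0I)
    then show False using P by (simp add: ev_pCons)
  qed
  ultimately show thesis by (rule that)
qed

lemma ev_sum: "ev a z = (\<Sum>i\<le>degree a. of_int (coeff a i) * z ^ i)"
  by (simp add: poly_altdef)

lemma monic_root_power:
  assumes "ev P x = 0" "lead_coeff P = 1"
  shows "x ^ degree P = (\<Sum>i<degree P. of_int (- coeff P i) * x ^ i)"
proof -
  have "0 = (\<Sum>i<degree P. of_int (coeff P i) * x ^ i) + x ^ degree P"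
    using assms by (simp add: ev_sum lessThan_Suc_atMost[symmetric])
  then show ?thesis by (simp add: sum_negf eq_neg_iff_add_eq_0 add.commute)
qed

text \<open>Only the top power \<open>x ^ degree P\<close> leaves the list of generators, and the
  monic equation rewrites it. The factor set \<open>B\<close> is free, so that a second integer or a
  quadratic element can be carried along.\<close>

lemma power_span_closed:
  fixes B :: "complex set"
  assumes P: "ev P x = 0" "lead_coeff P = 1" and fin: "finite B"
  defines "S \<equiv> (\<lambda>(i, b). x ^ i * b) ` ({..<degree P} \<times> B)"
  assumes "s \<in> S"
  shows "x * s \<in> zspan S"
proof -
  from \<open>s \<in> S\<close> obtain i b where s: "s = x ^ i * b" "i < degree P" "b \<in> B"
    unfolding S_def by auto
  have fS: "finite S" unfolding S_def using fin by simp
  have base: "x ^ j * b \<in> zspan S" if "j < degree P" for j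
    using that s(3) by (intro zspan_base[OF fS]) (auto simp: S_def)
  show ?thesis
  proof (cases "Suc i = degree P")
    case True
    have "x * s = x ^ degree P * b" unfolding s(1) True[symmetric] by simp
    also have "\<dots> = (\<Sum>i<degree P. of_int (- coeff P i) * (x ^ i * b))"
      unfolding monic_root_power[OF P] by (simp add: sum_distrib_right mult.assoc)
    finally show ?thesis using base by (metis (no_types, lifting) zspan_sum zspan_scale lessThan_iff)
  next
    case False
    then have "Suc i < degree P" using s(2) by simp
    from base[OF this] show ?thesis unfolding s(1) by (simp add: mult.assoc)
  qed
qed

text \<open>The products of powers of \<open>x\<close> and \<open>y\<close> span one group that is
  stable under both, hence under \<open>x + y\<close> and \<open>x * y\<close>. Rewriting
  \<open>S\<close> as in \<open>S'\<close> exchanges the roles, so that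
  \<open>power_span_closed\<close> serves for \<open>y\<close> as well.\<close>

lemma algebraic_int_add_mult:
  fixes x y :: complex
  assumes "algebraic_int x" "algebraic_int y"
  shows "algebraic_int (x + y)" "algebraic_int (x * y)"
proof -
  obtain P where P: "ev P x = 0" "lead_coeff P = 1" "degree P > 0"
    using assms(1) by (rule algebraic_intE)
  obtain Q where Q: "ev Q y = 0" "lead_coeff Q = 1" "degree Q > 0"
    using assms(2) by (rule algebraic_intE)
  define B where "B = (\<lambda>i. y ^ i) ` {..<degree Q}"
  define C where "C = (\<lambda>i. x ^ i) ` {..<degree P}"
  define S where "S = (\<lambda>(i, b). x ^ i * b) ` ({..<degree P} \<times> B)"
  have S': "S = (\<lambda>(i, b). y ^ i * b) ` ({..<degree Q} \<times> C)"
    unfolding S_def B_def C_def by (auto simp: image_iff mult.commute intro!: bexI; blast)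
  have fin: "finite S" unfolding S_def B_def by simp
  have x: "x * s \<in> zspan S" if "s \<in> S" for s
    using power_span_closed[OF P(1,2), of B s] that unfolding S_def B_def by simp
  have y: "y * s \<in> zspan S" if "s \<in> S" for s
    using power_span_closed[OF Q(1,2), of C s] that unfolding S' C_def by simp
  have one: "1 \<in> S" unfolding S_def B_def using P(3) Q(3)
    by (force intro!: image_eqI[of _ _ "(0, 1)"] image_eqI[of _ _ 0])
  show "algebraic_int (x + y)"
    using x y by (intro algebraic_int_if_zspan_closed[OF fin one]) (auto simp: distrib_right intro: zspan_add)
  show "algebraic_int (x * y)"
    using x y by (intro algebraic_int_if_zspan_closed[OF fin one])
      (auto simp: mult.assoc intro: zspan_mult_closed)
qed

lemma algebraic_int_add: "algebraic_int x \<Longrightarrow> algebraic_int y \<Longrightarrow> algebraic_int (x + y :: complex)"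
  and algebraic_int_mult: "algebraic_int x \<Longrightarrow> algebraic_int y \<Longrightarrow> algebraic_int (x * y :: complex)"
  by (rule algebraic_int_add_mult; assumption)+

text \<open>The generators \<open>t ^ i\<close> and \<open>t ^ i * x\<close> span a group stable
  under \<open>x\<close>, because the quadratic equation replaces \<open>x ^ 2\<close>. The element
  built in \<open>p_torsion_if_not_comaximal\<close> is integral for this reason.\<close>

lemma algebraic_int_quadratic:
  assumes "algebraic_int t" "x ^ 2 + ev a t * x + ev b t = 0"
  shows "algebraic_int x"
proof -
  obtain P where P: "ev P t = 0" "lead_coeff P = 1" "degree P > 0"
    using assms(1) by (rule algebraic_intE)
  define S where "S = (\<lambda>(i, b). t ^ i * b) ` ({..<degree P} \<times> {1, x})"
  have fin: "finite S" unfolding S_def by simp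
  have t: "t * s \<in> zspan S" if "s \<in> S" for s
    using power_span_closed[OF P(1,2), of "{1, x}" s] that unfolding S_def by simp
  note ev_closed = ev_mult_closed[of S t, OF zspan_mult_closed[OF t]]
  have one: "1 \<in> S" unfolding S_def using P(3)
    by (force intro!: image_eqI[of _ _ "(0, 1)"])
  have S: "t ^ i \<in> zspan S" "t ^ i * x \<in> zspan S" if "i < degree P" for i
    by (rule zspan_base[OF fin], use that in \<open>force simp: S_def\<close>)+
  have "x * s \<in> zspan S" if "s \<in> S" for s
  proof -
    from that obtain i where i: "i < degree P" "s = t ^ i \<or> s = t ^ i * x"
      unfolding S_def by auto
    from i(2) show ?thesis
    proof
      assume "s = t ^ i"
      then show ?thesis using S(2)[OF i(1)] by (simp add: mult.commute)
    next
      assume s: "s = t ^ i * x"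
      have x2: "x ^ 2 = - ev a t * x - ev b t"
        using assms(2) by (simp add: algebra_simps eq_neg_iff_add_eq_0)
      have "x * s = x ^ 2 * t ^ i" unfolding s by (simp add: power2_eq_square)
      also have "\<dots> = ev (-a) t * (t ^ i * x) + ev (-b) t * t ^ i"
        unfolding x2 by (simp add: ev_simps algebra_simps)
      finally have "x * s = ev (-a) t * (t ^ i * x) + ev (-b) t * t ^ i" .
      then show ?thesis using S[OF i(1)] ev_closed by (auto intro: zspan_add)
    qed
  qed
  then show ?thesis by (intro algebraic_int_if_zspan_closed[OF fin one]) auto
qed

lemma algebraic_int_sum: "(\<And>i. i \<in> I \<Longrightarrow> algebraic_int (f i :: complex)) \<Longrightarrow> algebraic_int (sum f I)"
  by (induction I rule: infinite_finite_induct) (auto intro: algebraic_int_add)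

lemma algebraic_int_prod: "(\<And>i. i \<in> I \<Longrightarrow> algebraic_int (f i :: complex)) \<Longrightarrow> algebraic_int (prod f I)"
  by (induction I rule: infinite_finite_induct) (auto intro: algebraic_int_mult int_imp_algebraic_int)

lemma algebraic_int_power: "algebraic_int (x :: complex) \<Longrightarrow> algebraic_int (x ^ n)"
  by (induction n) (auto intro: algebraic_int_mult int_imp_algebraic_int)

lemma algebraic_int_ev: "algebraic_int x \<Longrightarrow> algebraic_int (ev a x)"
  by (induction a) (auto simp: ev_pCons intro: algebraic_int_mult algebraic_int_add int_imp_algebraic_int)

section \<open>Integer polynomials modulo a prime\<close>

lemma monic_division:
  fixes f g :: "int poly"
  assumes "lead_coeff g = 1"
  obtains q r where "f = g * q + r" "r = 0 \<or> degree r < degree g"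
proof -
  obtain q r where qr: "pseudo_divmod f g = (q, r)" by fastforce
  have "g \<noteq> 0" using assms by auto
  from pseudo_divmod[OF this qr] assms show thesis by (intro that[of q r]) auto
qed

lemma coeff_of_int_mult: "coeff (of_int p * a :: int poly) n = p * coeff a n"
  by (simp add: of_int_poly)

lemma degree_of_int_mult_le: "degree (of_int p * a :: int poly) \<le> degree a"
  by (simp add: of_int_poly)

lemma of_int_dvd_poly_iff: "of_int p dvd (a :: int poly) \<longleftrightarrow> (\<forall>n. p dvd coeff a n)"
  by (simp add: of_int_poly const_poly_dvd_iff)

text \<open>In F_p[x] a nonzero polynomial has a monic scalar multiple. With integer
  representatives, leading terms divisible by \<open>p\<close> are stripped first, and
  \<open>u\<close> inverts the first leading coefficient prime to \<open>p\<close>.\<close>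

lemma exists_monic_mod_prime:
  fixes r :: "int poly"
  assumes p: "prime p" and "\<not> of_int p dvd r"
  shows "\<exists>u e. lead_coeff (smult u r + of_int p * e) = 1 \<and> degree (smult u r + of_int p * e) \<le> degree r"
  using assms(2)
proof (induction "degree r" arbitrary: r rule: less_induct)
  case less
  let ?d = "degree r"
  show ?case
  proof (cases "p dvd lead_coeff r")
    case False
    then have "Rings.coprime p (lead_coeff r)" using p by (rule prime_imp_coprime[rotated])
    then obtain v u where uv: "v * p + u * lead_coeff r = 1"
      by (metis bezout_int coprime_imp_gcd_eq_1)
    let ?m = "smult u r + of_int p * monom v ?d"
    have c: "coeff ?m ?d = 1" using uv by (simp add: coeff_of_int_mult algebra_simps)
    have d: "degree ?m \<le> ?d"
      by (intro degree_add_le) (auto intro: order.trans[OF degree_smult_le] order.trans[OF degree_of_int_mult_le] degree_monom_le)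
    then have "degree ?m = ?d" using c by (metis le_antisym le_degree zero_neq_one)
    then show ?thesis using c by (intro exI[of _ u] exI[of _ "monom v ?d"]) simp
  next
    case True
    then obtain c where c: "lead_coeff r = p * c" by (elim dvdE)
    define r' where "r' = r - of_int p * monom c ?d"
    have r': "\<not> of_int p dvd r'"
    proof
      assume "of_int p dvd r'"
      then have "of_int p dvd r' + of_int p * monom c ?d" by (rule dvd_add) simp
      then show False using less.prems by (simp add: r'_def)
    qed
    have c0: "coeff r' ?d = 0" unfolding r'_def using c by (simp add: coeff_of_int_mult)
    have le: "degree r' \<le> ?d" unfolding r'_def
      by (intro degree_diff_le) (auto intro: order.trans[OF degree_smult_le] order.trans[OF degree_of_int_mult_le] degree_monom_le)
    have "degree r' \<noteq> ?d"
    proof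
      assume "degree r' = ?d"
      then have "r' = 0" using c0 by (metis leading_coeff_0_iff)
      then show False using r' by simp
    qed
    then have "degree r' < ?d" using le by simp
    from less.hyps[OF this r'] obtain u e where
      ue: "lead_coeff (smult u r' + of_int p * e) = 1" "degree (smult u r' + of_int p * e) \<le> degree r'"
      by blast
    have "smult u r' + of_int p * e = smult u r + of_int p * (e - smult u (monom c ?d))"
      unfolding r'_def by (simp add: algebra_simps smult_diff_right)
    then show ?thesis using ue le by (metis order.trans)
  qed
qed

text \<open>Minimality replaces Euclid's algorithm: \<open>d\<close> is a monic element of least
  degree in the ideal generated by \<open>a\<close>, \<open>g\<close> and \<open>p\<close>. A
  remainder not divisible by \<open>p\<close> would yield a monic element of smaller degree.\<close>

lemma monic_gcd_mod_prime:
  fixes a g :: "int poly"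
  assumes p: "prime p" and g: "lead_coeff g = 1"
  obtains d A B C s t m l where "lead_coeff d = 1"
    "d = A * a + B * g + of_int p * C" "g = d * s + of_int p * t" "a = d * m + of_int p * l"
proof -
  define I where "I = {A * a + B * g + of_int p * C | A B C. True}"
  have I1: "g \<in> I" unfolding I_def by (intro CollectI exI[of _ 0] exI[of _ 1]) simp
  have I2: "a \<in> I" unfolding I_def
    by (intro CollectI exI[of _ 1] exI[of _ 0]) simp
  have I3: "x * y + z * w \<in> I" if xz: "x \<in> I" "z \<in> I" for x y z w
  proof -
    from xz obtain A B C A' B' C' where "x = A * a + B * g + of_int p * C"
      "z = A' * a + B' * g + of_int p * C'" unfolding I_def by auto
    then have "x * y + z * w = (A * y + A' * w) * a + (B * y + B' * w) * g + of_int p * (C * y + C' * w)"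
      by Groebner_Basis.algebra
    then show ?thesis unfolding I_def by blast
  qed
  have I4: "of_int p \<in> I" unfolding I_def by (intro CollectI exI[of _ 0] exI[of _ 1]) simp
  define d where "d = arg_min degree (\<lambda>x. x \<in> I \<and> lead_coeff x = 1)"
  have d: "d \<in> I" "lead_coeff d = 1" and dmin: "\<And>x. x \<in> I \<Longrightarrow> lead_coeff x = 1 \<Longrightarrow> degree d \<le> degree x"
    using arg_min_nat_lemma[of "\<lambda>x. x \<in> I \<and> lead_coeff x = 1" g degree] I1 g
    unfolding d_def by auto
  have dvd: "\<exists>s t. y = d * s + of_int p * t" if "y \<in> I" for y
  proof -
    obtain q r where qr: "y = d * q + r" "r = 0 \<or> degree r < degree d"
      using monic_division[OF d(2)] .
    have r: "r \<in> I" using I3[OF that d(1), of 1 "-q"] unfolding qr(1) by (simp add: algebra_simps)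
    have "of_int p dvd r"
    proof (rule ccontr)
      assume np: "\<not> of_int p dvd r"
      from exists_monic_mod_prime[OF p np] obtain u e where
        ue: "lead_coeff (smult u r + of_int p * e) = 1" "degree (smult u r + of_int p * e) \<le> degree r" by blast
      have "smult u r + of_int p * e \<in> I" using I3[OF r I4, of "[:u:]" e] by (simp add: mult.commute)
      from dmin[OF this ue(1)] ue(2) qr(2) np show False by auto
    qed
    then show ?thesis using qr(1) by (elim dvdE) auto
  qed
  from dvd[OF I1] dvd[OF I2] d show thesis unfolding I_def by (auto intro: that)
qed

text \<open>The Bezout form of coprimality in F_p[x], an identity that can be evaluated at an
  algebraic integer.\<close>

definition comaximal_mod :: "int \<Rightarrow> int poly \<Rightarrow> int poly \<Rightarrow> bool" where
  "comaximal_mod p a b \<longleftrightarrow> (\<exists>A B C. A * a + B * b = 1 + of_int p * C)"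

text \<open>Modulo \<open>p\<close>, a nonzero multiple of the monic \<open>d\<close> has degree at
  least that of \<open>d\<close>; so both \<open>c\<close> and the cofactor \<open>b\<close> vanish
  there.\<close>

lemma const_dvd_monic_mult:
  fixes d b c :: "int poly"
  assumes "p \<noteq> 0" "lead_coeff d = 1" "d * b = c + of_int p * e" "degree c < degree d"
  shows "of_int p dvd c" and "of_int p dvd b"
proof -
  obtain q r where qr: "e = d * q + r" "r = 0 \<or> degree r < degree d"
    using monic_division[OF assms(2)] .
  have eq: "c + of_int p * r = d * (b - of_int p * q)"
    using assms(3) unfolding qr(1) by Groebner_Basis.algebra
  have "degree (c + of_int p * r) < degree d"
    using qr(2) assms(4) by (intro degree_add_less) (auto intro: le_less_trans[OF degree_of_int_mult_le])
  moreover have "degree (d * x) \<ge> degree d" if "x \<noteq> 0" for x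
    using that assms(2) by (subst degree_mult_eq) auto
  ultimately have "c + of_int p * r = 0" unfolding eq by (metis mult_zero_right not_less)
  then have "c = of_int p * (- r)" by (simp add: eq_neg_iff_add_eq_0)
  then show "of_int p dvd c" by (metis dvd_triv_left)
  have "d \<noteq> 0" using assms(2) by auto
  then have "b = of_int p * q" using eq \<open>c + of_int p * r = 0\<close> by simp
  then show "of_int p dvd b" by simp
qed

lemma not_prime_const_dvd_1: "prime (p :: int) \<Longrightarrow> \<not> of_int p dvd (1 :: int poly)"
  by (auto simp: of_int_dvd_poly_iff dest: prime_gt_1_int spec[of _ 0])

lemma Mp_eq_iff: "poly_mod.Mp p a = poly_mod.Mp p b \<longleftrightarrow> of_int p dvd a - b"
  by (auto simp: poly_eq_iff poly_mod.Mp_coeff poly_mod.M_def of_int_dvd_poly_iff mod_eq_dvd_iff)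

text \<open>The gcd \<open>d\<close> modulo \<open>p\<close> is a common divisor, so coprimality
  makes it divide 1. Being monic, it equals 1, and its Bezout representation is the comaximality
  relation.\<close>

lemma coprime_m_iff_comaximal:
  assumes p: "prime p" and g: "lead_coeff g = 1"
  shows "poly_mod.coprime_m p a g \<longleftrightarrow> comaximal_mod p a g"
proof -
  have dvdm: "poly_mod.dvdm p x y \<longleftrightarrow> (\<exists>z w. y = x * z + of_int p * w)" for x y
    unfolding poly_mod.dvdm_def Mp_eq_iff dvd_def by (metis add_diff_cancel_left' diff_add_cancel add.commute)
  show ?thesis
  proof
    assume cop: "poly_mod.coprime_m p a g"
    obtain d A B C s t m l where d: "lead_coeff d = 1" "d = A * a + B * g + of_int p * C"
      "g = d * s + of_int p * t" "a = d * m + of_int p * l"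
      using monic_gcd_mod_prime[OF p g, of a] .
    from d(3,4) cop have "poly_mod.dvdm p d 1" unfolding poly_mod.coprime_m_def dvdm by blast
    then obtain z w where "1 = d * z + of_int p * w" unfolding dvdm by blast
    then have zw: "d * z = 1 + of_int p * (- w)" by Groebner_Basis.algebra
    have "degree d = 0"
    proof (rule ccontr)
      assume "degree d \<noteq> 0"
      then have "of_int p dvd (1 :: int poly)" using p by (intro const_dvd_monic_mult(1)[OF _ d(1) zw]) auto
      then show False using not_prime_const_dvd_1[OF p] by blast
    qed
    then have "d = 1" using d(1) monic_degree_0 by blast
    then have "A * a + B * g = 1 + of_int p * (- C)" using d(2) by Groebner_Basis.algebra
    then show "comaximal_mod p a g" unfolding comaximal_mod_def by blast
  next
    assume "comaximal_mod p a g"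
    then obtain A B C where ABC: "A * a + B * g = 1 + of_int p * C" unfolding comaximal_mod_def by blast
    show "poly_mod.coprime_m p a g" unfolding poly_mod.coprime_m_def dvdm
    proof clarify
      fix k z w z' w' assume "a = k * z + of_int p * w" "g = k * z' + of_int p * w'"
      with ABC have "1 = k * (A * z + B * z') + of_int p * (A * w + B * w' - C)" by Groebner_Basis.algebra
      then show "\<exists>z w. 1 = k * z + of_int p * w" by blast
    qed
  qed
qed

lemma comaximal_mod_cong:
  assumes "a = a' + of_int p * c"
  shows "comaximal_mod p a b \<longleftrightarrow> comaximal_mod p a' b"
proof -
  have *: "comaximal_mod p a' b" if "comaximal_mod p a b" "a = a' + of_int p * c" for a a' c
  proof -
    from that obtain A B C where "A * a + B * b = 1 + of_int p * C" unfolding comaximal_mod_def by blast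
    with that(2) have "A * a' + B * b = 1 + of_int p * (C - A * c)" by Groebner_Basis.algebra
    then show ?thesis unfolding comaximal_mod_def by blast
  qed
  have "a' = a + of_int p * (- c)" using assms by Groebner_Basis.algebra
  from * [OF _ assms] *[OF _ this] show ?thesis by blast
qed

lemma comaximal_mod_mult:
  assumes "comaximal_mod p a b" "comaximal_mod p a' b"
  shows "comaximal_mod p (a * a') b"
proof -
  from assms obtain A B C A' B' C' where
    1: "A * a + B * b = 1 + of_int p * C" and 2: "A' * a' + B' * b = 1 + of_int p * C'"
    unfolding comaximal_mod_def by blast
  have "(A * A') * (a * a') + (A * a * B' + B * A' * a' + B * B' * b) * b
      = (A * a + B * b) * (A' * a' + B' * b)" by Groebner_Basis.algebra
  also have "\<dots> = 1 + of_int p * (C + C' + of_int p * C * C')"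
    unfolding 1 2 by (simp add: algebra_simps)
  finally show ?thesis unfolding comaximal_mod_def by blast
qed

lemma comaximal_mod_power:
  assumes "n > 0"
  shows "comaximal_mod p (a ^ n) b \<longleftrightarrow> comaximal_mod p a b"
proof
  assume "comaximal_mod p (a ^ n) b"
  then obtain A B C where "A * a ^ n + B * b = 1 + of_int p * C" unfolding comaximal_mod_def by blast
  moreover have "a ^ n = a ^ (n - 1) * a" using assms by (metis power_minus_mult)
  ultimately have "(A * a ^ (n - 1)) * a + B * b = 1 + of_int p * C" by (simp add: mult.assoc)
  then show "comaximal_mod p a b" unfolding comaximal_mod_def by blast
next
  assume "comaximal_mod p a b"
  then show "comaximal_mod p (a ^ n) b"
  proof (induction n)
    case 0
    have "1 * a ^ 0 + 0 * b = 1 + of_int p * 0" by simp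
    then show ?case unfolding comaximal_mod_def by blast
  next
    case (Suc n)
    then show ?case using comaximal_mod_mult[OF \<open>comaximal_mod p a b\<close>] by simp
  qed
qed

text \<open>\<open>r\<close> is a monic divisor of \<open>g\<close> modulo \<open>p\<close> of least degree such that \<open>g\<close> divides a power of \<open>r\<close>;
  replacing \<open>r\<close> by its gcd with \<open>a\<close> cannot lower the degree. This avoids factoring modulo \<open>p\<close>.\<close>
lemma radical_mod_prime:
  fixes g :: "int poly"
  assumes p: "prime p" and g: "lead_coeff g = 1"
  obtains r n s t x y where "lead_coeff r = 1" "g = r * s + of_int p * t" "r ^ n = g * x + of_int p * y"
    "\<And>a k x y. a ^ k = r * x + of_int p * y \<Longrightarrow> \<exists>x y. a = r * x + of_int p * y"
proof -
  have p0: "p \<noteq> 0" using p by auto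
  define Q where "Q r \<longleftrightarrow> lead_coeff r = 1 \<and> (\<exists>s t. g = r * s + of_int p * t) \<and>
    (\<exists>n x y. r ^ n = g * x + of_int p * y)" for r
  have "Q g" unfolding Q_def using g
    by (intro conjI exI[of _ 1] exI[of _ 0]) auto
  define r where "r = arg_min degree Q"
  have r: "Q r" and rmin: "\<And>x. Q x \<Longrightarrow> degree r \<le> degree x"
    using arg_min_nat_lemma[of Q g degree] \<open>Q g\<close> unfolding r_def by auto
  from r obtain s t n x y where r': "lead_coeff r = 1" "g = r * s + of_int p * t" "r ^ n = g * x + of_int p * y"
    unfolding Q_def by blast
  have "\<exists>x y. a = r * x + of_int p * y" if ak: "a ^ k = r * x' + of_int p * y'" for a k x' y'
  proof -
    obtain d A B C s' t' m l where d: "lead_coeff d = 1" "d = A * a + B * r + of_int p * C"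
      "r = d * s' + of_int p * t'" "a = d * m + of_int p * l"
      using monic_gcd_mod_prime[OF p r'(1), of a] .
    \<comment> \<open>\<open>d\<close> is congruent to \<open>A * a\<close> modulo \<open>r\<close>
      and \<open>p\<close>. As \<open>r\<close> divides \<open>a ^ k\<close> modulo
      \<open>p\<close>, it then divides \<open>d ^ k\<close> as well.\<close>
    have pow: "\<exists>B' C'. d ^ j = A ^ j * a ^ j + B' * r + of_int p * C'" for j
    proof (induction j)
      case 0
      have "d ^ 0 = A ^ 0 * a ^ 0 + 0 * r + of_int p * 0" by simp
      then show ?case by blast
    next
      case (Suc j)
      then obtain B' C' where IH: "d ^ j = A ^ j * a ^ j + B' * r + of_int p * C'" by blast
      have "d ^ Suc j = (A * a + B * r + of_int p * C) * (A ^ j * a ^ j + B' * r + of_int p * C')"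
        unfolding power_Suc IH[symmetric] using d(2) by simp
      also have "\<dots> = A ^ Suc j * a ^ Suc j + (A * a * B' + B * A ^ j * a ^ j + B * B' * r + of_int p * C * B') * r
         + of_int p * (A * a * C' + B * r * C' + C * A ^ j * a ^ j + of_int p * C * C')"
        unfolding power_Suc by Groebner_Basis.algebra
      finally show ?case by blast
    qed
    from pow[of k] obtain B' C' where "d ^ k = A ^ k * a ^ k + B' * r + of_int p * C'" by blast
    with ak have dk: "d ^ k = r * (A ^ k * x' + B') + of_int p * (A ^ k * y' + C')"
      unfolding ak by (simp add: algebra_simps)
    have pow2: "\<exists>z w. (d ^ k) ^ j = r ^ j * z + of_int p * w" for j
    proof (induction j)
      case 0
      have "(d ^ k) ^ 0 = r ^ 0 * 1 + of_int p * 0" by simp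
      then show ?case by blast
    next
      case (Suc j)
      then obtain z w where IH: "(d ^ k) ^ j = r ^ j * z + of_int p * w" by blast
      have "(d ^ k) ^ Suc j = r ^ Suc j * ((A ^ k * x' + B') * z) +
         of_int p * (r * (A ^ k * x' + B') * w + (A ^ k * y' + C') * (r ^ j * z + of_int p * w))"
        unfolding power_Suc[of "d ^ k"] IH unfolding dk power_Suc by Groebner_Basis.algebra
      then show ?case by blast
    qed
    from pow2[of n] obtain z w where "(d ^ k) ^ n = r ^ n * z + of_int p * w" by blast
    then have "d ^ (k * n) = g * (x * z) + of_int p * (y * z + w)"
      unfolding r'(3) power_mult by (simp add: algebra_simps)
    moreover have "g = d * (s' * s) + of_int p * (t' * s + t)" using r'(2) d(3) by Groebner_Basis.algebra
    \<comment> \<open>Modulo \<open>p\<close>, \<open>g\<close> divides a power of \<open>d\<close>,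
      and \<open>d\<close> divides \<open>r\<close> and hence \<open>g\<close>. So \<open>d\<close>
      competes with \<open>r\<close> for the least degree.\<close>
    ultimately have "Q d" unfolding Q_def using d(1) by blast
    then have "degree r \<le> degree d" by (rule rmin)
    have "degree r = degree d"
    proof (rule antisym)
      show "degree d \<le> degree r"
      proof (rule ccontr)
        assume "\<not> degree d \<le> degree r"
        moreover have "d * s' = r + of_int p * - t'" using d(3) by Groebner_Basis.algebra
        ultimately have "of_int p dvd r"
          using const_dvd_monic_mult(1)[OF p0 d(1), of s' r "- t'"] by simp
        then have "p dvd lead_coeff r" unfolding of_int_dvd_poly_iff by blast
        then show False using r'(1) prime_gt_1_int[OF p] by simp
      qed
    qed fact
    \<comment> \<open>Monic polynomials of equal degree, one dividing the other modulo
      \<open>p\<close>, agree modulo \<open>p\<close>.\<close>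
    have "of_int p dvd r - d"
    proof (cases "r = d")
      case False
      then have "degree (r - d) < degree d"
        using \<open>degree r = degree d\<close> d(1) r'(1)
        by (intro degree_less_if_less_eqI) (auto intro: degree_diff_le)
      moreover have "d * (s' - 1) = (r - d) + of_int p * - t'" using d(3) by Groebner_Basis.algebra
      ultimately show ?thesis using const_dvd_monic_mult(1)[OF p0 d(1)] by blast
    qed simp
    then obtain w where "r - d = of_int p * w" by (elim dvdE)
    then have "a = r * m + of_int p * (l - w * m)" using d(4) by Groebner_Basis.algebra
    then show ?thesis by blast
  qed
  with r' show thesis by (rule that)
qed

section \<open>Binomial congruences and the expansion of f(x^(p^u)) modulo p^2\<close>

lemma add_power_mod_square:
  fixes a b :: "'a :: comm_ring_1"
  shows "\<exists>c. (a + b) ^ k = a ^ k + of_nat k * a ^ (k - 1) * b + b ^ 2 * c"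
proof (induction k)
  case 0
  have "(a + b) ^ 0 = a ^ 0 + of_nat 0 * a ^ (0 - 1) * b + b ^ 2 * 0" by simp
  then show ?case by blast
next
  case (Suc k)
  then obtain c where c: "(a + b) ^ k = a ^ k + of_nat k * a ^ (k - 1) * b + b ^ 2 * c" by blast
  have "of_nat k * a ^ (k - 1) * a = of_nat k * a ^ k" by (cases k) (simp_all add: mult.commute)
  then have "(a + b) ^ Suc k = a ^ Suc k + of_nat (Suc k) * a ^ (Suc k - 1) * b
      + b ^ 2 * (of_nat k * a ^ (k - 1) + (a + b) * c)"
    unfolding power_Suc c by (simp add: algebra_simps power2_eq_square)
  then show ?case by blast
qed

lemma add_prime_power:
  fixes a b :: "'a :: comm_ring_1"
  assumes "prime p"
  shows "\<exists>c. (a + b) ^ p = a ^ p + b ^ p + of_nat p * c"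
proof -
  have p: "p > 0" using assms by (rule prime_gt_0_nat)
  have "(a + b) ^ p = (\<Sum>k\<le>p. of_nat (p choose k) * a ^ k * b ^ (p - k))"
    by (rule binomial_ring)
  also have "{..p} = insert 0 (insert p {0<..<p})" by auto
  also have "(\<Sum>k\<in>\<dots>. of_nat (p choose k) * a ^ k * b ^ (p - k)) =
      b ^ p + a ^ p + (\<Sum>k\<in>{0<..<p}. of_nat (p choose k) * a ^ k * b ^ (p - k))"
    using p by simp
  also have "(\<Sum>k\<in>{0<..<p}. of_nat (p choose k) * a ^ k * b ^ (p - k)) =
      (\<Sum>k\<in>{0<..<p}. of_nat p * (of_nat ((p choose k) div p) * a ^ k * b ^ (p - k)))"
  proof (rule sum.cong[OF refl])
    fix k assume "k \<in> {0<..<p}"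
    then have "p dvd (p choose k)" using assms by (intro dvd_choose_prime) auto
    then have "p choose k = p * ((p choose k) div p)" by simp
    then show "of_nat (p choose k) * a ^ k * b ^ (p - k) =
        of_nat p * (of_nat ((p choose k) div p) * a ^ k * b ^ (p - k))"
      by (metis mult.assoc of_nat_mult)
  qed
  also have "\<dots> = of_nat p * (\<Sum>k\<in>{0<..<p}. of_nat ((p choose k) div p) * a ^ k * b ^ (p - k))"
    by (simp add: sum_distrib_left)
  finally show ?thesis by (metis add.commute)
qed

lemma int_power_prime_cong:
  assumes "prime p" shows "\<exists>c. (a :: int) ^ p = a + int p * c"
proof (induction a rule: int_induct[of _ 0])
  case base
  show ?case using prime_gt_0_nat[OF assms] by (intro exI[of _ 0]) simp
next
  case (step1 i)
  obtain c where "(i + 1) ^ p = i ^ p + 1 ^ p + of_nat p * c" using add_prime_power[OF assms] by blast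
  moreover obtain d where "i ^ p = i + int p * d" using step1 by blast
  ultimately show ?case by (intro exI[of _ "c + d"]) (simp add: algebra_simps)
next
  case (step2 i)
  obtain c where "((i - 1) + 1) ^ p = (i - 1) ^ p + 1 ^ p + of_nat p * c"
    using add_prime_power[OF assms] by blast
  moreover obtain d where "i ^ p = i + int p * d" using step2 by blast
  ultimately show ?case by (intro exI[of _ "d - c"]) (simp add: algebra_simps)
qed

text \<open>Frobenius on F_p[x] fixes the coefficients, by Fermat's little theorem, and sends x to
  x^p. The cofactor of \<open>p\<close> is the polynomial \<open>h\<close> of the theorem.\<close>

lemma pcompose_monom_prime:
  fixes f :: "int poly"
  assumes "prime p"
  shows "\<exists>c. f \<circ>\<^sub>p monom 1 p = f ^ p + of_nat p * c"
proof (induction f)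
  case 0
  show ?case using prime_gt_0_nat[OF assms] by (intro exI[of _ 0]) (simp add: power_0_left)
next
  case (pCons a f)
  obtain c where c: "f \<circ>\<^sub>p monom 1 p = f ^ p + of_nat p * c" using pCons.IH by blast
  obtain d where d: "a ^ p = a + int p * d" using int_power_prime_cong[OF assms] by blast
  obtain e where e: "([:a:] + [:0, 1:] * f) ^ p = [:a:] ^ p + ([:0, 1:] * f) ^ p + of_nat p * e"
    using add_prime_power[OF assms] by blast
  have "pCons a f = [:a:] + [:0, 1:] * f" by simp
  moreover have "[:a:] ^ p = [:a:] + of_nat p * [:d:]"
    using d by (simp add: poly_const_pow of_nat_poly)
  moreover have "([:0, 1:] * f) ^ p = monom 1 p * f ^ p"
    by (simp only: power_mult_distrib monom_altdef smult_1_left)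
  ultimately have "pCons a f ^ p = [:a:] + monom 1 p * f ^ p + of_nat p * ([:d:] + e)"
    using e by (simp only: distrib_left add_ac)
  moreover have "pCons a f \<circ>\<^sub>p monom 1 p = [:a:] + monom 1 p * (f ^ p + of_nat p * c)"
    by (simp add: pcompose_pCons c)
  ultimately have "pCons a f \<circ>\<^sub>p monom 1 p = pCons a f ^ p + of_nat p * (monom 1 p * c - [:d:] - e)"
    by (simp add: algebra_simps)
  then show ?case by blast
qed

text \<open>Substituting x^p into the expansion for \<open>p ^ Suc v\<close> turns f into f^p + p h.
  Raised to a power divisible by \<open>p\<close>, this h leaves no trace modulo p^2, so the
  first-order term comes only from h(x^p), which is h^p modulo \<open>p\<close>.\<close>

lemma pcompose_monom_prime_power:
  fixes f h :: "int poly"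
  assumes p: "prime p" and h: "f \<circ>\<^sub>p monom 1 p = f ^ p + of_nat p * h"
  shows "\<exists>c. f \<circ>\<^sub>p monom 1 (p ^ Suc v) =
    f ^ (p ^ Suc v) + of_nat p * (h ^ (p ^ v) + of_nat p * c)"
proof (induction v)
  case 0
  show ?case using h by (intro exI[of _ 0]) simp
next
  case (Suc v)
  let ?P = "of_nat p :: int poly"
  let ?k = "p ^ Suc v"
  obtain c where c: "f \<circ>\<^sub>p monom 1 ?k = f ^ ?k + ?P * (h ^ (p ^ v) + ?P * c)"
    using Suc by blast
  have "monom 1 (p ^ Suc (Suc v)) = monom 1 ?k \<circ>\<^sub>p monom (1 :: int) p"
    by (simp add: monom_altdef pcompose_hom.hom_power pcompose_pCons power_mult[symmetric] mult.commute)
  then have "f \<circ>\<^sub>p monom 1 (p ^ Suc (Suc v)) = (f \<circ>\<^sub>p monom 1 ?k) \<circ>\<^sub>p monom 1 p"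
    by (simp add: pcompose_assoc)
  also have "\<dots> = (f ^ p + ?P * h) ^ ?k + ?P * ((h \<circ>\<^sub>p monom 1 p) ^ (p ^ v) + ?P * (c \<circ>\<^sub>p monom 1 p))"
    unfolding c by (simp add: pcompose_add pcompose_mult pcompose_smult pcompose_hom.hom_power h of_nat_poly del: power_Suc)
  finally have 1: "f \<circ>\<^sub>p monom 1 (p ^ Suc (Suc v)) = (f ^ p + ?P * h) ^ ?k +
     ?P * ((h \<circ>\<^sub>p monom 1 p) ^ (p ^ v) + ?P * (c \<circ>\<^sub>p monom 1 p))" .
  obtain d where d: "h \<circ>\<^sub>p monom 1 p = h ^ p + ?P * d" using pcompose_monom_prime[OF p] by blast
  obtain e where e: "(h ^ p + ?P * d) ^ (p ^ v) =
      (h ^ p) ^ (p ^ v) + of_nat (p ^ v) * (h ^ p) ^ (p ^ v - 1) * (?P * d) + (?P * d) ^ 2 * e"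
    using add_power_mod_square by blast
  define e' where "e' = of_nat (p ^ v) * (h ^ p) ^ (p ^ v - 1) * d + ?P * d ^ 2 * e"
  have 2: "(h \<circ>\<^sub>p monom 1 p) ^ (p ^ v) = h ^ (p ^ Suc v) + ?P * e'"
    unfolding d e e'_def by (simp add: power_mult[symmetric] algebra_simps power2_eq_square)
  obtain b where b: "(f ^ p + ?P * h) ^ ?k =
      (f ^ p) ^ ?k + of_nat ?k * (f ^ p) ^ (?k - 1) * (?P * h) + (?P * h) ^ 2 * b"
    using add_power_mod_square by blast
  \<comment> \<open>Both corrections carry p^2: in the linear term one factor comes from
    \<open>of_nat ?k\<close> and one from \<open>?P * h\<close>, and the other term contains
    \<open>?P ^ 2\<close>.\<close>
  define b' where "b' = of_nat (p ^ v) * (f ^ p) ^ (?k - 1) * h + h ^ 2 * b"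
  have 3: "(f ^ p + ?P * h) ^ ?k = f ^ (p ^ Suc (Suc v)) + ?P * (?P * b')"
    unfolding b b'_def by (simp add: power_mult[symmetric] algebra_simps power2_eq_square)
  show ?case unfolding 1 2 3
    by (intro exI[of _ "e' + c \<circ>\<^sub>p monom 1 p + b'"]) (simp only: distrib_left add_ac)
qed

section \<open>Torsion in a finite quotient\<close>

text \<open>The form in which the theorems of Lagrange and Sylow can be applied to the
  quotient.\<close>

definition additive_monoid :: "complex set \<Rightarrow> complex monoid" where
  "additive_monoid A = \<lparr>carrier = A, mult = (+), one = 0\<rparr>"

locale additive_subgroup_pair =
  fixes A B :: "complex set"
  assumes A_add: "\<And>x y. x \<in> A \<Longrightarrow> y \<in> A \<Longrightarrow> x + y \<in> A"
    and A_minus: "\<And>x. x \<in> A \<Longrightarrow> - x \<in> A"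
    and B_0: "0 \<in> B" and B_diff: "\<And>x y. x \<in> B \<Longrightarrow> y \<in> B \<Longrightarrow> x - y \<in> B"
    and B_subset: "B \<subseteq> A"
    and finite_cosets: "finite ((\<lambda>\<alpha>. (+) \<alpha> ` B) ` A)"
begin

abbreviation M where "M \<equiv> additive_monoid A"
abbreviation Q where "Q \<equiv> M Mod B"

lemma B_minus: "x \<in> B \<Longrightarrow> - x \<in> B"
  using B_diff[OF B_0] by simp

lemma B_add: "x \<in> B \<Longrightarrow> y \<in> B \<Longrightarrow> x + y \<in> B"
  using B_diff[of x "- y"] B_minus by simp

lemma A_0: "0 \<in> A"
  using B_0 B_subset by blast

lemma comm_group_M: "comm_group M"
  by (rule comm_groupI)
    (auto simp: additive_monoid_def A_add A_0 add_ac intro!: bexI[of _ "- x" for x] A_minus)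

lemma inv_M: "x \<in> A \<Longrightarrow> inv\<^bsub>M\<^esub> x = - x"
  by (rule group.inv_equality[OF comm_group.axioms(2)[OF comm_group_M]])
    (auto simp: additive_monoid_def A_minus)

lemma subgroup_B: "subgroup B M"
proof (rule group.subgroupI[OF comm_group.axioms(2)[OF comm_group_M]])
  show "B \<subseteq> carrier M" "B \<noteq> {}" using B_subset B_0 by (auto simp: additive_monoid_def)
  show "inv\<^bsub>M\<^esub> x \<in> B" if "x \<in> B" for x
    using that B_subset by (subst inv_M) (auto intro: B_minus)
  show "x \<otimes>\<^bsub>M\<^esub> y \<in> B" if "x \<in> B" "y \<in> B" for x y
    using that by (simp add: additive_monoid_def B_add)
qed

lemma normal_B: "B \<lhd> M"
  by (rule comm_group.subgroup_imp_normal[OF comm_group_M subgroup_B])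

lemma group_Q: "group Q"
  by (rule normal.factorgroup_is_group[OF normal_B])

lemma coset_eq: "B #>\<^bsub>M\<^esub> x = (+) x ` B"
  by (auto simp: r_coset_def additive_monoid_def add.commute)

lemma carrier_Q: "carrier Q = (\<lambda>\<alpha>. (+) \<alpha> ` B) ` A"
  by (auto simp: FactGroup_def RCOSETS_def coset_eq) (auto simp: additive_monoid_def)

lemma order_Q: "order Q = additive_index A B"
  unfolding order_def carrier_Q additive_index_def ..

lemma one_Q: "\<one>\<^bsub>Q\<^esub> = B"
  by (simp add: FactGroup_def)

lemma coset_eq_B: "x \<in> A \<Longrightarrow> (+) x ` B = B \<longleftrightarrow> x \<in> B"
proof
  assume "(+) x ` B = B"
  then show "x \<in> B" using B_0 by (metis add.right_neutral image_eqI)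
next
  assume x: "x \<in> B"
  show "(+) x ` B = B"
  proof (intro equalityI subsetI)
    fix y assume "y \<in> B"
    then show "y \<in> (+) x ` B" using B_diff[OF _ x, of y] by (intro image_eqI[of _ _ "y - x"]) auto
  qed (use x B_add in blast)
qed

lemma pow_Q: "x \<in> A \<Longrightarrow> ((+) x ` B) [^]\<^bsub>Q\<^esub> n = (+) (of_nat n * x) ` B"
proof (induction n)
  case 0
  have "(+) 0 ` B = B" by simp
  then show ?case by (simp add: FactGroup_def)
next
  case (Suc n)
  have A: "of_nat k * x \<in> A" for k
    by (induction k) (auto simp: A_0 distrib_right intro: A_add Suc.prems)
  have "((+) x ` B) [^]\<^bsub>Q\<^esub> Suc n = (B #>\<^bsub>M\<^esub> (of_nat n * x)) <#>\<^bsub>M\<^esub> (B #>\<^bsub>M\<^esub> x)"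
    using Suc by (simp add: FactGroup_def coset_eq)
  also have "\<dots> = B #>\<^bsub>M\<^esub> (of_nat n * x \<otimes>\<^bsub>M\<^esub> x)"
    using A Suc.prems by (intro normal.rcos_sum[OF normal_B]) (auto simp: additive_monoid_def)
  also have "\<dots> = (+) (of_nat (Suc n) * x) ` B"
    unfolding coset_eq by (simp add: additive_monoid_def distrib_right add.commute)
  finally show ?case .
qed

lemma index_pos: "additive_index A B > 0"
  unfolding additive_index_def using A_0 finite_cosets by (auto simp: card_gt_0_iff)

text \<open>One direction is Cauchy's theorem, read off from Sylow's with exponent 1. In the other
  the order of the coset is \<open>q\<close>, and Lagrange's theorem applies.\<close>

lemma prime_dvd_index_iff:
  assumes q: "prime q"
  shows "q dvd additive_index A B \<longleftrightarrow> (\<exists>x\<in>A. x \<notin> B \<and> of_nat q * x \<in> B)"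
proof
  assume "q dvd additive_index A B"
  then obtain k where k: "order Q = q ^ 1 * k" unfolding order_Q by auto
  have "finite (carrier Q)" unfolding carrier_Q by (rule finite_cosets)
  from sylow_thm[OF q group_Q k this] obtain H where H: "subgroup H Q" "card H = q" by auto
  then have "card H > 1" using q prime_gt_1_nat by blast
  then have "\<not> H \<subseteq> {B}" using card_mono[of "{B}" H] by auto
  then obtain c where c: "c \<in> H" "c \<noteq> B" by blast
  have G: "group (Q\<lparr>carrier := H\<rparr>)" by (rule subgroup.subgroup_is_group[OF H(1) group_Q])
  have "c [^]\<^bsub>Q\<lparr>carrier := H\<rparr>\<^esub> q = B"
    using group.pow_order_eq_1[OF G, of c] c(1) H(2) by (simp add: order_def one_Q)
  then have cq: "c [^]\<^bsub>Q\<^esub> q = B" by (simp add: nat_pow_def)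
  have "c \<in> carrier Q" using c(1) subgroup.subset[OF H(1)] by blast
  then obtain x where x: "x \<in> A" "c = (+) x ` B" unfolding carrier_Q by blast
  have "of_nat k * x \<in> A" for k
    by (induction k) (auto simp: A_0 distrib_right intro: A_add x)
  then have "of_nat q * x \<in> B" using cq coset_eq_B unfolding x(2) pow_Q[OF x(1)] by blast
  moreover have "x \<notin> B" using c(2) coset_eq_B[OF x(1)] unfolding x(2) by blast
  ultimately show "\<exists>x\<in>A. x \<notin> B \<and> of_nat q * x \<in> B" using x(1) by blast
next
  assume "\<exists>x\<in>A. x \<notin> B \<and> of_nat q * x \<in> B"
  then obtain x where x: "x \<in> A" "x \<notin> B" "of_nat q * x \<in> B" by blast
  let ?c = "(+) x ` B"
  have c: "?c \<in> carrier Q" unfolding carrier_Q using x(1) by blast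
  have "?c [^]\<^bsub>Q\<^esub> q = \<one>\<^bsub>Q\<^esub>"
    unfolding pow_Q[OF x(1)] one_Q using coset_eq_B x(3) B_subset by blast
  then have "group.ord Q ?c dvd q" using group.pow_eq_id[OF group_Q c] by blast
  moreover have "group.ord Q ?c \<noteq> 1"
    using group.ord_eq_1[OF group_Q c] coset_eq_B[OF x(1)] x(2) one_Q by simp
  ultimately have "group.ord Q ?c = q" using q by (auto simp: prime_nat_iff)
  then show "q dvd additive_index A B"
    using group.ord_dvd_group_order[OF group_Q c] order_Q by simp
qed

text \<open>A prime \<open>q\<close> other than \<open>p\<close> dividing the index would give an
  \<open>x\<close> outside \<open>B\<close> with q x in \<open>B\<close>. As p^k x is in
  \<open>B\<close> too, Bezout puts \<open>x\<close> in \<open>B\<close>.\<close>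

lemma index_prime_power:
  assumes p: "prime p" and kill: "\<And>x. x \<in> A \<Longrightarrow> of_nat (p ^ k) * x \<in> B"
  shows "\<exists>s. additive_index A B = p ^ s"
proof -
  have only_p: "q = p" if q: "prime q" "q dvd additive_index A B" for q
  proof (rule ccontr)
    assume "q \<noteq> p"
    from q obtain x where x: "x \<in> A" "x \<notin> B" "of_nat q * x \<in> B"
      using prime_dvd_index_iff by blast
    have mult: "of_int n * y \<in> B" if "y \<in> B" for n y
      by (induction n rule: int_induct[of _ 0])
        (auto simp: B_0 algebra_simps intro: B_add B_diff that)
    have "Rings.coprime (int q) (int (p ^ k))"
      using \<open>q \<noteq> p\<close> q(1) p by (simp add: primes_coprime)
    then obtain u v where "u * int q + v * int (p ^ k) = 1"
      by (metis bezout_int coprime_imp_gcd_eq_1)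
    then have "of_int (u * int q + v * int (p ^ k)) = (1 :: complex)" by simp
    then have "x = of_int (u * int q + v * int (p ^ k)) * x" by simp
    also have "\<dots> = of_int u * (of_nat q * x) + of_int v * (of_nat (p ^ k) * x)"
      by (simp add: algebra_simps)
    also have "\<dots> \<in> B" using x(3) kill[OF x(1)] by (intro B_add mult)
    finally show False using x(2) by blast
  qed
  have "additive_index A B \<noteq> 0" "\<not> is_unit p" using index_pos p by auto
  then obtain m where m: "additive_index A B = p ^ multiplicity p (additive_index A B) * m" "\<not> p dvd m"
    by (rule multiplicity_decompose')
  have "m = 1"
  proof (rule ccontr)
    assume "m \<noteq> 1"
    then obtain q where q: "prime q" "q dvd m" using prime_factor_nat by blast
    then have "q dvd additive_index A B" by (metis m(1) dvd_mult)
    from only_p[OF q(1) this] m(2) q(2) show False by blast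
  qed
  then show ?thesis using m(1) by auto
qed

end

section \<open>The ring of integers and the order generated by a root\<close>

lemma degree_of_int_poly_rat: "degree (map_poly of_int a :: rat poly) = degree a"
  by (rule degree_map_poly) auto

lemma evq_of_int_poly: "evq (map_poly of_int a) z = ev a z"
  by (simp only: of_rat_of_int_poly)

text \<open>Once powers of \<open>D\<close> are cancelled, the constant term of \<open>P\<close> is
  nonzero and a multiple of \<open>D\<close> in \<int>[D]. This trades an algebraic denominator for
  an integer.\<close>

lemma nonzero_root_divides_int:
  assumes "ev P D = 0" "P \<noteq> 0" "D \<noteq> 0"
  shows "\<exists>c Q. c \<noteq> 0 \<and> of_int c = D * ev Q D"
  using assms
proof (induction P)
  case 0
  then show ?case by simp
next
  case (pCons c Q)
  show ?case
  proof (cases "c = 0")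
    case True
    then show ?thesis using pCons by (auto simp: ev_pCons)
  next
    case False
    have "of_int c = D * ev (- Q) D" using pCons.prems(1)
      by (simp add: ev_pCons ev_simps eq_neg_iff_add_eq_0)
    then show ?thesis using False by blast
  qed
qed

lemma algebraic_int_coeff_mult:
  fixes a b :: "complex poly"
  assumes "\<And>i. algebraic_int (coeff a i)" "\<And>i. algebraic_int (coeff b i)"
  shows "algebraic_int (coeff (a * b) i)"
  unfolding coeff_mult by (intro algebraic_int_sum algebraic_int_mult assms)

lemma algebraic_int_coeff_prod:
  fixes f :: "'i \<Rightarrow> complex poly"
  assumes "\<And>x i. x \<in> I \<Longrightarrow> algebraic_int (coeff (f x) i)"
  shows "algebraic_int (coeff (prod f I) i)"
  using assms
proof (induction I arbitrary: i rule: infinite_finite_induct)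
  case (insert x F)
  then show ?case by (simp add: algebraic_int_coeff_mult)
qed (auto simp: coeff_1 intro: int_imp_algebraic_int)

locale monic_irreducible_root =
  fixes g :: "int poly" and \<theta> :: complex
  assumes monic: "lead_coeff g = 1"
    and irr: "irreducible (map_poly of_int g :: rat poly)"
    and root: "ev g \<theta> = 0"
begin

abbreviation \<O> where "\<O> \<equiv> integer_ring (rat_adjoin \<theta>)"
abbreviation R where "R \<equiv> int_adjoin \<theta>"
abbreviation G :: "rat poly" where "G \<equiv> map_poly of_int g"

lemma degree_G: "degree G = degree g"
  by (rule degree_of_int_poly_rat)

lemma degree_pos: "degree g > 0"
proof (rule ccontr)
  assume "\<not> degree g > 0"
  then have "g = 1" using monic monic_degree_0 by blast
  then show False using root by simp
qed

lemma algebraic_int_root: "algebraic_int \<theta>"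
  unfolding algebraic_int_altdef_ipoly using root monic by blast

lemma evq_eq_0: assumes "evq q \<theta> = 0" shows "G dvd q"
proof (rule ccontr)
  assume False: "\<not> G dvd q"
  from irr have "prime_elem G" by (rule irreducible_imp_prime_elem)
  then have "algebraic_semidom_class.coprime G q" using False by (rule prime_elem_imp_coprime)
  then have "gcd G q = 1" by simp
  then obtain u v where "u * G + v * q = 1"
    using bezout_coefficients_fst_snd[of G q] by metis
  then have "evq (u * G + v * q) \<theta> = 1" by simp
  then show False
    using assms root by (simp add: of_rat_poly.hom_add of_rat_poly.hom_mult evq_of_int_poly)
qed

lemma evq_eq_0_small: "evq q \<theta> = 0 \<Longrightarrow> degree q < degree g \<Longrightarrow> q = 0"
  using evq_eq_0[of q] dvd_imp_degree_le[of G q] degree_G by fastforce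

lemma ev_eq_0_small: "ev r \<theta> = 0 \<Longrightarrow> degree r < degree g \<Longrightarrow> r = 0"
  using evq_eq_0_small[of "map_poly of_int r"] by (simp add: evq_of_int_poly degree_of_int_poly_rat)

lemma ev_reduce:
  obtains r c where "a = r + g * c" "degree r < degree g" "ev a \<theta> = ev r \<theta>"
proof -
  obtain q r where qr: "a = g * q + r" "r = 0 \<or> degree r < degree g" using monic_division[OF monic] .
  then have "degree r < degree g" using degree_pos by auto
  moreover have "ev a \<theta> = ev r \<theta>" unfolding qr(1) using root by (simp add: ev_simps)
  ultimately show thesis using qr(1) by (intro that[of r q]) simp_all
qed

lemma ev_eqE:
  assumes "ev a \<theta> = ev b \<theta>" obtains c where "a = b + g * c"
proof -
  obtain r c where rc: "a - b = r + g * c" "degree r < degree g" "ev (a - b) \<theta> = ev r \<theta>" by (rule ev_reduce)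
  have "ev (a - b) \<theta> = 0" using assms by (simp add: ev_simps)
  then have "r = 0" using ev_eq_0_small[OF _ rc(2)] rc(3) by simp
  then show thesis using rc(1) by (intro that[of c]) (simp add: algebra_simps)
qed

text \<open>A Bezout relation with the irreducible \<open>G\<close> inverts the denominator;
  reduction modulo \<open>G\<close> then bounds the degree.\<close>

lemma rat_adjoinE:
  assumes "x \<in> rat_adjoin \<theta>"
  obtains a where "x = evq a \<theta>" "degree a < degree g"
proof -
  from assms obtain a b where x: "x = evq a \<theta> / evq b \<theta>" and b: "evq b \<theta> \<noteq> 0"
    unfolding rat_adjoin_def by blast
  have nd: "\<not> G dvd b"
  proof
    assume "G dvd b"
    then show False using b root by (auto simp: of_rat_poly.hom_mult evq_of_int_poly elim!: dvdE)
  qed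
  from irr have "prime_elem G" by (rule irreducible_imp_prime_elem)
  then have "algebraic_semidom_class.coprime G b" using nd by (rule prime_elem_imp_coprime)
  then have "gcd G b = 1" by simp
  then obtain u v where "u * G + v * b = 1"
    using bezout_coefficients_fst_snd[of G b] by metis
  then have "evq (u * G + v * b) \<theta> = 1" by simp
  then have "evq v \<theta> * evq b \<theta> = 1"
    using root by (simp add: of_rat_poly.hom_add of_rat_poly.hom_mult evq_of_int_poly)
  then have "x = evq (a * v) \<theta>" unfolding x using b by (simp add: of_rat_poly.hom_mult field_simps)
  also have "\<dots> = evq (G * (a * v div G) + a * v mod G) \<theta>" by (simp only: mult_div_mod_eq)
  also have "\<dots> = evq (a * v mod G) \<theta>"
    by (simp only: of_rat_poly.hom_add of_rat_poly.hom_mult poly_add poly_mult evq_of_int_poly root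
      mult_zero_left add_0)
  finally have "x = evq (a * v mod G) \<theta>" .
  moreover have "degree (a * v mod G) < degree g"
    using degree_mod_less[of G "a * v"] degree_pos
    unfolding degree_G[symmetric] by (metis degree_0 not_less_zero)
  ultimately show thesis by (rule that)
qed

lemma evq_in_rat_adjoin: "evq a \<theta> \<in> rat_adjoin \<theta>"
  unfolding rat_adjoin_def by (intro CollectI exI[of _ a] exI[of _ 1]) simp

lemma O_iff: "x \<in> \<O> \<longleftrightarrow> algebraic_int x \<and> (\<exists>a. x = evq a \<theta>)"
  unfolding integer_ring_def using evq_in_rat_adjoin rat_adjoinE by blast

lemma R_iff: "x \<in> R \<longleftrightarrow> (\<exists>a. x = ev a \<theta>)"
  unfolding int_adjoin_def by blast

lemma ev_in_R: "ev a \<theta> \<in> R"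
  unfolding R_iff by blast

lemma R_add: "x \<in> R \<Longrightarrow> y \<in> R \<Longrightarrow> x + y \<in> R"
  unfolding R_iff by (metis of_int_poly_hom.hom_add poly_add)

lemma R_mult: "x \<in> R \<Longrightarrow> y \<in> R \<Longrightarrow> x * y \<in> R"
  unfolding R_iff by (metis of_int_poly_hom.hom_mult poly_mult)

lemma R_diff: "x \<in> R \<Longrightarrow> y \<in> R \<Longrightarrow> x - y \<in> R"
  unfolding R_iff by (metis of_int_poly_hom.hom_minus poly_diff)

lemma R_sum: "(\<And>i. i \<in> I \<Longrightarrow> f i \<in> R) \<Longrightarrow> sum f I \<in> R"
  using ev_in_R[of 0] by (induction I rule: infinite_finite_induct) (auto intro: R_add)

lemma R_subset_O: "R \<subseteq> \<O>"
proof
  fix x assume "x \<in> R"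
  then obtain a where "x = ev a \<theta>" unfolding R_iff by blast
  then show "x \<in> \<O>" unfolding O_iff using algebraic_int_ev[OF algebraic_int_root, of a]
      evq_of_int_poly[of a \<theta>] by metis
qed

lemma O_add: "x \<in> \<O> \<Longrightarrow> y \<in> \<O> \<Longrightarrow> x + y \<in> \<O>"
  unfolding O_iff by (metis algebraic_int_add of_rat_poly.hom_add poly_add)

lemma O_mult: "x \<in> \<O> \<Longrightarrow> y \<in> \<O> \<Longrightarrow> x * y \<in> \<O>"
  unfolding O_iff by (metis algebraic_int_mult of_rat_poly.hom_mult poly_mult)

lemma O_diff: "x \<in> \<O> \<Longrightarrow> y \<in> \<O> \<Longrightarrow> x - y \<in> \<O>"
  using O_add[of x "ev (-1) \<theta> * y"] O_mult[of "ev (-1) \<theta>" y] R_subset_O ev_in_R[of "-1"]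
  by (auto simp: ev_simps)

text \<open>The integral equation is a rational polynomial condition on \<theta>, hence it holds at
  every root of \<open>g\<close>.\<close>

lemma algebraic_int_conjugate:
  assumes "algebraic_int (evq a \<theta>)" "ev g z = 0"
  shows "algebraic_int (evq a z)"
proof -
  obtain P where P: "ev P (evq a \<theta>) = 0" "lead_coeff P = 1" "degree P > 0"
    using assms(1) by (rule algebraic_intE)
  let ?q = "map_poly of_int P \<circ>\<^sub>p a :: rat poly"
  have q: "evq ?q w = ev P (evq a w)" for w
    by (simp add: of_rat_hom.map_poly_pcompose poly_pcompose of_rat_of_int_poly)
  have "evq ?q z = 0"
    by (rule rat_poly_root_transfer[OF irr, of \<theta>]) (use root assms(2) P(1) q in \<open>simp_all only: evq_of_int_poly\<close>)
  then show ?thesis unfolding q algebraic_int_altdef_ipoly using P(2) by blast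
qed

text \<open>Separability in characteristic 0: the prime \<open>G\<close> cannot divide its
  derivative, which is nonzero of smaller degree, so Bezout excludes multiple roots.\<close>

lemma card_roots: "card {z. ev g z = 0} = degree g"
proof -
  have "\<not> G dvd pderiv G"
  proof
    assume "G dvd pderiv G"
    moreover have "pderiv G \<noteq> 0" using degree_pos degree_G by (simp add: pderiv_eq_0_iff)
    ultimately have "degree G \<le> degree (pderiv G)" by (rule dvd_imp_degree_le)
    then show False using degree_pos degree_G by (simp add: degree_pderiv)
  qed
  moreover from irr have "prime_elem G" by (rule irreducible_imp_prime_elem)
  ultimately have "algebraic_semidom_class.coprime G (pderiv G)" by (intro prime_elem_imp_coprime)
  then have "gcd G (pderiv G) = 1" by simp
  then obtain u v where uv: "u * G + v * pderiv G = 1"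
    using bezout_coefficients_fst_snd[of G "pderiv G"] by metis
  have "evq (u * G + v * pderiv G) z = 1" for z unfolding uv by simp
  then have "\<not> (evq G z = 0 \<and> evq (pderiv G) z = 0)" for z
    by (metis (no_types, lifting) of_rat_poly.hom_add of_rat_poly.hom_mult poly_add poly_mult
        mult_zero_right add_0 zero_neq_one)
  moreover have "evq (pderiv G) z = poly (pderiv (map_poly of_int g)) z" for z
    by (simp add: of_rat_hom.map_poly_pderiv of_rat_of_int_poly)
  ultimately have sf: "rsquarefree (map_poly of_int g :: complex poly)"
    unfolding rsquarefree_roots evq_of_int_poly by metis
  let ?g = "map_poly of_int g :: complex poly"
  have "?g = (\<Prod>z|ev g z = 0. [:-z, 1:])"
    using complex_poly_decompose_rsquarefree[OF sf] monic by simp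
  then have "degree ?g = degree (\<Prod>z|ev g z = 0. [:-z, 1:])" by simp
  also have "\<dots> = card {z. ev g z = 0}"
    by (subst degree_prod_eq_sum_degree) auto
  finally show ?thesis by simp
qed

text \<open>Lagrange interpolation at the conjugates of \<open>\<theta>\<close>; \<open>D\<close> is the discriminant up to sign.\<close>
lemma bounded_denominator: "\<exists>d::int. d > 0 \<and> (\<forall>x\<in>\<O>. of_int d * x \<in> R)"
proof -
  define Z where "Z = {z. ev g z = 0}"
  have fin: "finite Z" using degree_pos card_roots unfolding Z_def by (metis card.infinite less_irrefl)
  define E where "E z = (\<Prod>w\<in>Z - {z}. z - w)" for z
  define D where "D = (\<Prod>z\<in>Z. E z)"
  have E0: "E z \<noteq> 0" for z unfolding E_def using fin by auto
  then have D0: "D \<noteq> 0" unfolding D_def using fin by auto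
  have Zint: "algebraic_int z" if "z \<in> Z" for z
    using that monic unfolding Z_def algebraic_int_altdef_ipoly by blast
  have minus: "algebraic_int (x - y)" if "algebraic_int x" "algebraic_int y" for x y :: complex
    using algebraic_int_add[OF that(1), of "-y"] that(2) by simp
  have Eint: "algebraic_int (E z)" if "z \<in> Z" for z
    unfolding E_def by (intro algebraic_int_prod minus Zint) (use that in auto)
  then have "algebraic_int D" unfolding D_def by (auto intro!: algebraic_int_prod)
  then obtain P where P: "ev P D = 0" "lead_coeff P = 1" "degree P > 0" by (rule algebraic_intE)
  then have "P \<noteq> 0" by auto
  from nonzero_root_divides_int[OF P(1) this D0] obtain c Q where c: "c \<noteq> 0" "of_int c = D * ev Q D"
    by blast
  have coeff_int: "of_int c * of_rat (coeff a k) \<in> (\<int> :: complex set)"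
    if a: "algebraic_int (evq a \<theta>)" "degree a < degree g" for a k
  proof -
    \<comment> \<open>Interpolation of \<open>a\<close> with all denominators cleared:
      \<open>prod E (Z - {z})\<close> is \<open>D / E z\<close>. Every ingredient is integral, so
      the coefficients of D a are.\<close>
    define L where "L = (\<Sum>z\<in>Z. smult (evq a z * prod E (Z - {z})) (\<Prod>w\<in>Z - {z}. [:-w, 1:]))"
    have "smult D (map_poly of_rat a) = L"
    proof (rule poly_eqI_degree[of Z])
      fix y assume y: "y \<in> Z"
      have "poly L y = (\<Sum>z\<in>Z. evq a z * prod E (Z - {z}) * (\<Prod>w\<in>Z - {z}. y - w))"
        unfolding L_def by (simp add: poly_sum poly_prod)
      also have "\<dots> = (\<Sum>z\<in>Z. if z = y then evq a y * prod E (Z - {y}) * E y else 0)"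
      proof (intro sum.cong refl)
        fix z assume "z \<in> Z"
        show "evq a z * prod E (Z - {z}) * (\<Prod>w\<in>Z - {z}. y - w) =
          (if z = y then evq a y * prod E (Z - {y}) * E y else 0)"
          using y fin by (auto simp: E_def)
      qed
      also have "\<dots> = evq a y * (E y * prod E (Z - {y}))" using fin y by simp
      also have "\<dots> = evq a y * D" unfolding D_def using prod.remove[OF fin y, of E] by simp
      finally show "poly (smult D (map_poly of_rat a)) y = poly L y" by (simp add: mult.commute)
    next
      have "degree (map_poly complex_of_rat a) = degree a" by (rule degree_map_poly) auto
      then show "degree (smult D (map_poly complex_of_rat a)) < card Z"
        using a(2) card_roots by (simp add: Z_def D0)
      have "degree L \<le> card Z - 1" unfolding L_def
      proof (intro degree_sum_le fin order.trans[OF degree_smult_le])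
        fix z assume "z \<in> Z"
        then show "degree (\<Prod>w\<in>Z - {z}. [:- w, 1:]) \<le> card Z - 1"
          using fin by (subst degree_prod_eq_sum_degree) auto
      qed
      then show "degree L < card Z" using degree_pos card_roots by (simp add: Z_def)
    qed
    then have "D * of_rat (coeff a k) = coeff L k"
      by (metis coeff_smult of_rat_hom.coeff_map_poly_hom)
    moreover have "algebraic_int (coeff L k)"
      unfolding L_def coeff_sum coeff_smult
    proof (intro algebraic_int_sum algebraic_int_mult algebraic_int_prod)
      show "algebraic_int (evq a z)" if "z \<in> Z" for z
        using algebraic_int_conjugate[OF a(1)] that unfolding Z_def by blast
      show "algebraic_int (E w)" if "w \<in> Z - {z}" for w z
        using Eint that by blast
      show "algebraic_int (coeff (\<Prod>w\<in>Z - {z}. [:- w, 1:]) k)" for z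
        by (rule algebraic_int_coeff_prod)
          (auto simp: coeff_pCons Zint split: nat.splits intro: int_imp_algebraic_int)
    qed
    \<comment> \<open>The factor \<open>ev Q D\<close> turns \<open>D\<close> into the integer
      \<open>c\<close>; the product is then both rational and integral.\<close>
    ultimately have "algebraic_int (D * of_rat (coeff a k) * ev Q D)"
      using algebraic_int_ev[OF \<open>algebraic_int D\<close>] by (auto intro: algebraic_int_mult)
    then have "algebraic_int (of_int c * of_rat (coeff a k) :: complex)" unfolding c(2) by (simp add: mult_ac)
    then show ?thesis by (rule rational_algebraic_int_is_int) auto
  qed
  have cO: "of_int c * x \<in> R" if "x \<in> \<O>" for x
  proof -
    from that obtain a where a: "x = evq a \<theta>" "degree a < degree g" "algebraic_int x"
      unfolding integer_ring_def by (auto elim: rat_adjoinE)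
    have "of_int c * x = (\<Sum>k\<le>degree a. (of_int c * of_rat (coeff a k)) * \<theta> ^ k)"
      unfolding a(1) poly_altdef by (simp add: sum_distrib_left mult.assoc)
    also have "\<dots> \<in> R"
    proof (rule R_sum, rule R_mult)
      fix k
      obtain m where "of_int c * of_rat (coeff a k) = complex_of_int m"
        using coeff_int[of a k] a by (auto elim: Ints_cases)
      then show "of_int c * of_rat (coeff a k) \<in> R" using ev_in_R[of "[:m:]"] by (simp add: ev_pCons)
      show "\<theta> ^ k \<in> R" using ev_in_R[of "monom 1 k"] by (simp add: poly_monom)
    qed
    finally show ?thesis .
  qed
  show ?thesis
  proof (cases "c > 0")
    case True
    then show ?thesis using cO by blast
  next
    case False
    have "of_int (- c) * x \<in> R" if "x \<in> \<O>" for x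
      using R_diff[OF ev_in_R[of 0] cO[OF that]] by simp
    then show ?thesis using False c(1) by (intro exI[of _ "-c"]) auto
  qed
qed

text \<open>With \<open>d\<close> a common denominator, each coset is represented by
  \<open>ev r0 \<theta> / of_int d\<close>, where \<open>r0\<close> has degree below that of
  \<open>g\<close> and coefficients in \<open>{0..<d}\<close>. There are finitely many such
  coefficient lists.\<close>

lemma finite_cosets: "finite ((\<lambda>\<alpha>. (+) \<alpha> ` R) ` \<O>)"
proof -
  obtain d :: int where d: "d > 0" "\<And>x. x \<in> \<O> \<Longrightarrow> of_int d * x \<in> R"
    using bounded_denominator by blast
  define S where "S = {xs :: int list. set xs \<subseteq> {0..<d} \<and> length xs \<le> degree g}"
  have "finite S" unfolding S_def by (rule finite_lists_length_le) simp
  have "(\<lambda>\<alpha>. (+) \<alpha> ` R) ` \<O> \<subseteq> (\<lambda>xs. (+) (ev (Poly xs) \<theta> / of_int d) ` R) ` S"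
  proof clarify
    fix x assume "x \<in> \<O>"
    then obtain a where "of_int d * x = ev a \<theta>" using d(2) R_iff by blast
    moreover obtain r c where r: "a = r + g * c" "degree r < degree g" "ev a \<theta> = ev r \<theta>" by (rule ev_reduce)
    ultimately have x: "of_int d * x = ev r \<theta>" by simp
    define r0 where "r0 = map_poly (\<lambda>c. c mod d) r"
    define r1 where "r1 = map_poly (\<lambda>c. c div d) r"
    have "r = r0 + smult d r1"
      by (rule poly_eqI) (simp add: r0_def r1_def coeff_map_poly)
    then have "ev r \<theta> = ev (r0 + smult d r1) \<theta>" by (rule arg_cong)
    then have "of_int d * x = ev r0 \<theta> + of_int d * ev r1 \<theta>"
      unfolding x by (simp add: of_int_hom.map_poly_hom_smult of_int_poly_hom.hom_add)
    moreover have "of_int d * (ev r0 \<theta> / of_int d + ev r1 \<theta>) = ev r0 \<theta> + of_int d * ev r1 \<theta>"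
      using d(1) by (simp add: distrib_left)
    ultimately have "of_int d * x = of_int d * (ev r0 \<theta> / of_int d + ev r1 \<theta>)" by simp
    then have xr: "x = ev r0 \<theta> / of_int d + ev r1 \<theta>"
      using d(1) by simp
    have "(+) x ` R = (+) (ev (Poly (coeffs r0)) \<theta> / of_int d) ` R"
    proof (intro equalityI subsetI)
      fix y assume "y \<in> (+) x ` R"
      then obtain z where z: "z \<in> R" "y = x + z" by blast
      then show "y \<in> (+) (ev (Poly (coeffs r0)) \<theta> / of_int d) ` R"
        using R_add[OF ev_in_R[of r1] z(1)] by (auto simp: xr add.assoc)
    next
      fix y assume "y \<in> (+) (ev (Poly (coeffs r0)) \<theta> / of_int d) ` R"
      then obtain z where z: "z \<in> R" "y = ev r0 \<theta> / of_int d + z" by auto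
      then have "y = x + (z - ev r1 \<theta>)" by (simp add: xr)
      then show "y \<in> (+) x ` R" using R_diff[OF z(1) ev_in_R[of r1]] by blast
    qed
    moreover have "coeffs r0 \<in> S"
    proof -
      have "c \<in> {0..<d}" if "c \<in> set (coeffs r0)" for c
        using that d(1) by (auto simp: coeffs_def r0_def coeff_map_poly split: if_splits)
      moreover have "length (coeffs r0) \<le> degree g"
      proof (cases "r0 = 0")
        case False
        have "degree r0 \<le> degree r" unfolding r0_def by (rule degree_map_poly_le)
        then show ?thesis using False r(2) by (simp add: length_coeffs_degree)
      qed simp
      ultimately show ?thesis unfolding S_def by blast
    qed
    ultimately show "(+) x ` R \<in> (\<lambda>xs. (+) (ev (Poly xs) \<theta> / of_int d) ` R) ` S" by blast
  qed
  then show ?thesis using \<open>finite S\<close> by (meson finite_imageI finite_subset)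
qed

end

section \<open>Dedekind's criterion\<close>

context monic_irreducible_root
begin

text \<open>Otherwise \<open>p\<close> would be a unit in \<open>R\<close>, whereas R/pR is
  F_p[x]/(g), nonzero because \<open>g\<close> is monic of positive degree.\<close>

lemma ev_one_plus_prime_mult_nonzero:
  assumes p: "prime p" and e: "ev (1 + of_int p * e) \<theta> = 0"
  shows False
proof -
  have "ev (1 + of_int p * e) \<theta> = ev 0 \<theta>" using e by simp
  then obtain c where "1 + of_int p * e = 0 + g * c" by (rule ev_eqE)
  then have c: "g * c = 1 + of_int p * e" by simp
  have "of_int p dvd (1 :: int poly)"
    by (rule const_dvd_monic_mult(1)[OF _ monic c]) (use p degree_pos in auto)
  then show False using not_prime_const_dvd_1[OF p] by blast
qed

lemma ev_of_int: "ev (of_int c) z = of_int c"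
  by (simp add: of_int_poly ev_pCons)

lemma R_power: "x \<in> R \<Longrightarrow> x ^ n \<in> R"
  using ev_in_R[of 1] by (induction n) (auto intro: R_mult)

text \<open>Locally at \<open>p\<close> the radical \<open>r\<close> of \<open>f\<close> modulo \<open>p\<close> generates the radical of \<open>p R\<close>: comaximality
  makes \<open>v\<close> with \<open>p v = r z\<close> a unit modulo \<open>p\<close>. Multiplying a torsion element by powers of \<open>r\<close> yields an
  integral \<open>\<beta>\<close> outside \<open>R\<close> with \<open>r \<beta>\<close> and \<open>p \<beta>\<close> in \<open>R\<close>; integrality puts \<open>r \<beta>\<close> into the
  radical \<open>(r, p)\<close>, and cancelling \<open>r\<close> gives \<open>\<beta> \<in> R\<close>.\<close>
lemma no_p_torsion_if_comaximal:
  assumes p: "prime p" and f: "lead_coeff f = 1" and k: "k \<ge> 2"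
    and g: "g = f ^ k + of_int p * m" and com: "comaximal_mod p m f"
    and x: "x \<in> \<O>" "of_int p * x \<in> R"
  shows "x \<in> R"
proof -
  have p0: "p \<noteq> 0" using p by auto
  obtain r n s t x' y' where r: "lead_coeff r = 1" "f = r * s + of_int p * t"
    "r ^ n = f * x' + of_int p * y'"
    and red: "\<And>a k x y. a ^ k = r * x + of_int p * y \<Longrightarrow> \<exists>x y. a = r * x + of_int p * y"
    using radical_mod_prime[OF p f] by metis
  obtain k' where k': "k = Suc (Suc k')" using k by (metis add_2_eq_Suc le_Suc_ex)
  let ?e = "\<lambda>a. ev a \<theta>"
  \<comment> \<open>Two factors f = r s + p t of \<open>f ^ k\<close> are expanded: the term with
    p^2 joins \<open>m\<close> in \<open>v\<close>, and everything divisible by \<open>r\<close>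
    goes into -r z.\<close>
  define v where "v = m + of_int p * (t ^ 2 * f ^ k')"
  define z where "z = - (f ^ k' * (r * s ^ 2 + of_int p * (2 * s * t)))"
  have fk: "f ^ k = f ^ k' * (r * s + of_int p * t) ^ 2"
    unfolding k' r(2)[symmetric] by (simp add: power2_eq_square mult_ac)
  have "g = of_int p * v - r * z"
    unfolding g fk v_def z_def by (simp add: algebra_simps power2_eq_square)
  then have pv: "of_int p * ?e v = ?e r * ?e z"
    using root by (simp add: ev_simps ev_of_int)
  have "comaximal_mod p f m" using com unfolding comaximal_mod_def by (metis add.commute)
  then have "comaximal_mod p (f ^ k) m" using k by (subst comaximal_mod_power) auto
  then obtain A B C where ABC: "A * f ^ k + B * m = 1 + of_int p * C"
    unfolding comaximal_mod_def by blast
  \<comment> \<open>Substituting f^k = g - p m in the Bezout relation leads to this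
    \<open>w\<close>, whose value at \<theta> inverts that of \<open>v\<close> modulo
    \<open>p\<close>.\<close>
  define w where "w = B - of_int p * A"
  define c where "c = C + w * t ^ 2 * f ^ k'"
  have "w * v = 1 + of_int p * c - A * g"
    using ABC unfolding w_def v_def c_def g by (simp add: algebra_simps)
  from arg_cong[OF this, of ?e] have wv: "?e w * ?e v = 1 + of_int p * ?e c"
    using root by (simp add: ev_simps ev_of_int)
  have r0: "?e r \<noteq> 0"
  proof
    assume "?e r = 0"
    then have "?e v = 0" using pv p0 by simp
    then have "?e (1 + of_int p * c) = 0" using wv by (simp add: ev_simps ev_of_int)
    then show False by (rule ev_one_plus_prime_mult_nonzero[OF p])
  qed
  \<comment> \<open>Modulo \<open>p\<close>, \<open>f\<close> divides \<open>r ^ n\<close>, so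
    \<open>g\<close>, congruent to \<open>f ^ k\<close>, divides \<open>r ^ (n * k)\<close>. At
    \<theta> this power is a multiple of \<open>p\<close>, and p x lies in \<open>R\<close>.\<close>
  have "?e r ^ (n * k) * x \<in> R"
  proof -
    obtain b where b: "(f * x' + of_int p * y') ^ k = (f * x') ^ k
        + of_nat k * (f * x') ^ (k - 1) * (of_int p * y') + (of_int p * y') ^ 2 * b"
      using add_power_mod_square by blast
    define d where "d = of_nat k * (f * x') ^ (k - 1) * y' + of_int p * y' ^ 2 * b - m * x' ^ k"
    have "r ^ (n * k) = g * x' ^ k + of_int p * d"
      unfolding power_mult r(3) b d_def g
      by (simp add: algebra_simps power2_eq_square power_mult_distrib)
    from arg_cong[OF this, of ?e] have "?e (r ^ (n * k)) = of_int p * ?e d"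
      using root by (simp add: ev_simps ev_of_int)
    then have "?e r ^ (n * k) * x = ?e d * (of_int p * x)" by (simp add: ev_simps)
    then show ?thesis using R_mult[OF ev_in_R x(2), of d] by (simp only:)
  qed
  then have j: "?e r ^ (LEAST j. ?e r ^ j * x \<in> R) * x \<in> R" by (rule LeastI)
  show ?thesis
  proof (cases "LEAST j. ?e r ^ j * x \<in> R")
    case 0
    then show ?thesis using j by simp
  next
    case (Suc j')
    define \<beta> where "\<beta> = ?e r ^ j' * x"
    have r\<beta>: "?e r * \<beta> \<in> R" using j unfolding Suc \<beta>_def by (simp add: mult.assoc)
    have "\<beta> \<notin> R" unfolding \<beta>_def by (rule not_less_Least) (simp add: Suc)
    have p\<beta>: "of_int p * \<beta> \<in> R"
      using R_mult[OF R_power[OF ev_in_R[of r], of j'] x(2)] unfolding \<beta>_def by (simp add: mult_ac)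
    have "\<beta> \<in> \<O>"
      unfolding \<beta>_def using R_power[OF ev_in_R] R_subset_O x(1) by (blast intro: O_mult)
    then have "algebraic_int \<beta>" unfolding O_iff by blast
    then obtain P where P: "ev P \<beta> = 0" "lead_coeff P = 1" "degree P > 0" by (rule algebraic_intE)
    obtain a where a: "?e r * \<beta> = ?e a" using r\<beta> unfolding R_iff by blast
    let ?d = "degree P"
    \<comment> \<open>The monic equation of \<beta> is multiplied by the power \<open>?d\<close> of
      \<open>r\<close>. Each lower term keeps a spare factor \<open>r\<close> after its powers of r
      \<beta> are formed, so \<open>r\<close> divides the left side in \<open>R\<close>.\<close>
    have "(?e r * \<beta>) ^ ?d = (\<Sum>i<?d. ?e r ^ ?d * (of_int (- coeff P i) * \<beta> ^ i))"
      unfolding power_mult_distrib monic_root_power[OF P(1,2)] by (simp add: sum_distrib_left)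
    also have "\<dots> = (\<Sum>i<?d. ?e r * (of_int (- coeff P i) * ?e r ^ (?d - Suc i) * (?e r * \<beta>) ^ i))"
    proof (intro sum.cong refl)
      fix i assume "i \<in> {..<?d}"
      then have "?d = Suc (i + (?d - Suc i))" by simp
      then have "?e r ^ ?d = ?e r * ?e r ^ i * ?e r ^ (?d - Suc i)" by (metis power_Suc power_add mult.assoc)
      then show "?e r ^ ?d * (of_int (- coeff P i) * \<beta> ^ i)
        = ?e r * (of_int (- coeff P i) * ?e r ^ (?d - Suc i) * (?e r * \<beta>) ^ i)"
        by (simp add: power_mult_distrib)
    qed
    also have "\<dots> = ?e r * (\<Sum>i<?d. of_int (- coeff P i) * ?e r ^ (?d - Suc i) * (?e r * \<beta>) ^ i)"
      by (simp only: sum_distrib_left)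
    finally have rd: "?e a ^ ?d = ?e r * (\<Sum>i<?d. of_int (- coeff P i) * ?e r ^ (?d - Suc i) * (?e r * \<beta>) ^ i)"
      unfolding a .
    have ofR: "of_int i \<in> R" for i using ev_in_R[of "of_int i"] by (simp add: ev_of_int)
    have "(\<Sum>i<?d. of_int (- coeff P i) * ?e r ^ (?d - Suc i) * (?e r * \<beta>) ^ i) \<in> R"
      by (intro R_sum R_mult R_power r\<beta> ev_in_R ofR)
    then obtain b where "(\<Sum>i<?d. of_int (- coeff P i) * ?e r ^ (?d - Suc i) * (?e r * \<beta>) ^ i) = ?e b"
      unfolding R_iff by blast
    with rd have "?e (a ^ ?d) = ?e (r * b)" by (simp add: ev_simps)
    then obtain c' where c': "a ^ ?d = r * b + g * c'" by (rule ev_eqE)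
    have "g = r * (s * f ^ Suc k') + of_int p * (t * f ^ Suc k' + m)"
      unfolding g k' using r(2) by (simp add: algebra_simps)
    with c' have "a ^ ?d = r * (b + s * f ^ Suc k' * c') + of_int p * ((t * f ^ Suc k' + m) * c')"
      by (simp add: algebra_simps)
    from red[OF this] obtain X Y where XY: "a = r * X + of_int p * Y" by blast
    have "?e r * (?e v * \<beta>) = ?e v * (?e r * ?e X + of_int p * ?e Y)"
      using a unfolding XY by (simp add: ev_simps ev_of_int mult_ac)
    also have "\<dots> = ?e r * (?e v * ?e X) + (of_int p * ?e v) * ?e Y" by (simp add: algebra_simps)
    also have "\<dots> = ?e r * (?e v * ?e X + ?e z * ?e Y)" unfolding pv by (simp add: algebra_simps)
    finally have "?e v * \<beta> = ?e v * ?e X + ?e z * ?e Y" using r0 by simp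
    \<comment> \<open>Multiplying by \<open>w\<close> replaces \<open>v\<close> by 1 + p c, and p
      \<beta> is already in \<open>R\<close>.\<close>
    then have "?e w * ?e v * \<beta> = ?e w * (?e v * ?e X + ?e z * ?e Y)" by simp
    then have "\<beta> = ?e w * (?e v * ?e X + ?e z * ?e Y) - ?e c * (of_int p * \<beta>)"
      unfolding wv by (simp add: algebra_simps)
    also have "\<dots> \<in> R" by (intro R_diff R_add R_mult ev_in_R p\<beta>)
    finally show ?thesis using \<open>\<beta> \<notin> R\<close> by blast
  qed
qed

text \<open>With \<open>d\<close> the gcd of \<open>m\<close> and \<open>f\<close> modulo \<open>p\<close>, the element \<open>\<alpha> = F/(d p)\<close>, read modulo \<open>p\<close>, maps the ideal
  \<open>(d, p)\<close> into itself; the determinant of that action is the quadratic equation for \<open>\<alpha>\<close>.\<close>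
lemma p_torsion_if_not_comaximal:
  assumes p: "prime p" and f: "lead_coeff f = 1" and k: "k \<ge> 2"
    and g: "g = f ^ k + of_int p * m" and ncom: "\<not> comaximal_mod p m f"
  shows "\<exists>x\<in>\<O>. x \<notin> R \<and> of_int p * x \<in> R"
proof -
  have p0: "p \<noteq> 0" using p by auto
  obtain d A B C s t m' l where d: "lead_coeff d = 1"
    "d = A * m + B * f + of_int p * C" "f = d * s + of_int p * t" "m = d * m' + of_int p * l"
    using monic_gcd_mod_prime[OF p f, of m] .
  have dpos: "degree d > 0"
  proof (rule ccontr)
    assume "\<not> degree d > 0"
    then have "d = 1" using d(1) monic_degree_0 by blast
    then have "A * m + B * f = 1 + of_int p * (- C)" using d(2) by Groebner_Basis.algebra
    then show False using ncom unfolding comaximal_mod_def by blast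
  qed
  obtain k' where k': "k = Suc (Suc k')" using k by (metis add_2_eq_Suc le_Suc_ex)
  let ?e = "\<lambda>a. ev a \<theta>"
  define w where "w = s ^ 2 * f ^ k'"
  define m1 where "m1 = 2 * s * t * f ^ k' + m'"
  define l1 where "l1 = l + t ^ 2 * f ^ k'"
  have fk: "f ^ k = f ^ k' * (d * s + of_int p * t) ^ 2"
    unfolding k' d(3)[symmetric] by (simp add: power2_eq_square mult_ac)
  \<comment> \<open>Again two factors f = d s + p t are expanded, and \<open>m\<close> is replaced
    by d m' + p l; all terms free of \<open>d\<close> then carry p^2.\<close>
  have gd: "g = d ^ 2 * w + of_int p * (d * m1 + of_int p * l1)"
    unfolding g fk w_def m1_def l1_def d(4) by (simp add: algebra_simps power2_eq_square)
  define \<alpha> where "\<alpha> = ?e d * ?e w / of_int p"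
  have p\<alpha>: "of_int p * \<alpha> = ?e d * ?e w" unfolding \<alpha>_def using p0 by simp
  have "?e d ^ 2 * ?e w + of_int p * (?e d * ?e m1 + of_int p * ?e l1) = 0"
    using arg_cong[OF gd, of ?e] root by (simp add: ev_simps ev_of_int)
  then have "of_int p * (?e d * \<alpha> + ?e d * ?e m1 + of_int p * ?e l1) = 0"
    using p\<alpha> by Groebner_Basis.algebra
  then have d\<alpha>: "?e d * \<alpha> + ?e d * ?e m1 + of_int p * ?e l1 = 0" using p0 by simp
  \<comment> \<open>This is the relation \<open>d\<alpha>\<close> times \<open>w\<close>, with d w
    replaced by p \<alpha>.\<close>
  have "of_int p * (\<alpha> ^ 2 + ?e m1 * \<alpha> + ?e (l1 * w)) = 0"
    using p\<alpha> d\<alpha> by (simp only: ev_simps poly_mult) Groebner_Basis.algebra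
  then have "\<alpha> ^ 2 + ?e m1 * \<alpha> + ?e (l1 * w) = 0" using p0 by simp
  then have "algebraic_int \<alpha>" by (rule algebraic_int_quadratic[OF algebraic_int_root])
  moreover have "\<alpha> \<in> rat_adjoin \<theta>"
    unfolding rat_adjoin_def
  proof (intro CollectI exI conjI)
    show "\<alpha> = evq (map_poly of_int (d * w)) \<theta> / evq (map_poly of_int (of_int p)) \<theta>"
      unfolding evq_of_int_poly \<alpha>_def by (simp add: ev_simps ev_of_int)
    show "evq (map_poly of_int (of_int p)) \<theta> \<noteq> 0"
      unfolding evq_of_int_poly ev_of_int using p0 by simp
  qed
  ultimately have "\<alpha> \<in> \<O>" unfolding integer_ring_def by blast
  moreover have "of_int p * \<alpha> \<in> R" unfolding p\<alpha> by (intro R_mult ev_in_R)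
  moreover have "\<alpha> \<notin> R"
  proof
    assume "\<alpha> \<in> R"
    then obtain b where "\<alpha> = ?e b" unfolding R_iff by blast
    then have "?e (d * w) = ?e (of_int p * b)" using p\<alpha> by (simp add: ev_simps ev_of_int)
    then obtain c where c: "d * w = of_int p * b + g * c" by (rule ev_eqE)
    \<comment> \<open>Eliminating d w between \<open>gd\<close> and \<open>c\<close> makes
      \<open>p\<close> divide \<open>g * (1 - d * c)\<close>. As \<open>g\<close> is monic,
      \<open>d\<close> would be invertible modulo \<open>p\<close>, against its positive
      degree.\<close>
    have "g * (1 - d * c) = 0 + of_int p * (d * b + d * m1 + of_int p * l1)"
      using gd c by Groebner_Basis.algebra
    then have "of_int p dvd 1 - d * c"
      by (rule const_dvd_monic_mult(2)[OF p0 monic]) (use degree_pos in simp)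
    then obtain e where "1 - d * c = of_int p * e" by (elim dvdE)
    then have "d * c = 1 + of_int p * (- e)" by Groebner_Basis.algebra
    then have "of_int p dvd (1 :: int poly)"
      by (rule const_dvd_monic_mult(1)[OF p0 d(1)]) (use dpos in simp)
    then show False using not_prime_const_dvd_1[OF p] by blast
  qed
  ultimately show ?thesis by blast
qed

lemma additive_subgroup_pair: "additive_subgroup_pair \<O> R"
proof
  show "x + y \<in> \<O>" if "x \<in> \<O>" "y \<in> \<O>" for x y using that by (rule O_add)
  have 0: "0 \<in> R" using ev_in_R[of 0] by simp
  then show "0 \<in> R" .
  show "- x \<in> \<O>" if "x \<in> \<O>" for x
    using O_diff[of 0 x] 0 R_subset_O that by auto
  show "x - y \<in> R" if "x \<in> R" "y \<in> R" for x y using that by (rule R_diff)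
  show "R \<subseteq> \<O>" by (rule R_subset_O)
  show "finite ((\<lambda>\<alpha>. (+) \<alpha> ` R) ` \<O>)" by (rule finite_cosets)
qed

lemma poly_index: "poly_index g = additive_index \<O> R"
  by (rule poly_index_eq[OF irr root])

theorem dedekind_criterion:
  assumes p: "prime (p :: nat)" and f: "lead_coeff f = 1" and k: "k \<ge> 2"
    and g: "g = f ^ k + of_int (int p) * m"
  shows "\<not> p dvd poly_index g \<longleftrightarrow> comaximal_mod (int p) m f"
proof -
  have p': "prime (int p)" using p by simp
  have "p dvd poly_index g \<longleftrightarrow> (\<exists>x\<in>\<O>. x \<notin> R \<and> of_int (int p) * x \<in> R)"
    unfolding poly_index additive_subgroup_pair.prime_dvd_index_iff[OF additive_subgroup_pair p] by simp
  then show ?thesis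
    using no_p_torsion_if_comaximal[OF p' f k g] p_torsion_if_not_comaximal[OF p' f k g] by blast
qed

end

section \<open>Roots of unity and the power-compositional polynomial\<close>

text \<open>Every prime occurs in \<open>n\<close> at most once, and each prime factor of
  \<open>n\<close> divides \<open>a\<close>; in other words \<int>/n is reduced.\<close>

lemma squarefree_dvd_power:
  fixes n a :: int
  assumes n: "squarefree n" and dvd: "n dvd a ^ k"
  shows "n dvd a"
proof (cases "a = 0")
  case False
  have "n \<noteq> 0" using n by auto
  show ?thesis
  proof (rule multiplicity_le_imp_dvd[OF \<open>n \<noteq> 0\<close>])
    fix q :: int assume q: "prime q"
    show "multiplicity q n \<le> multiplicity q a"
    proof (cases "q dvd n")
      case True
      then have "q dvd a ^ k" using dvd by (rule dvd_trans)
      then have "q dvd a" using q by (rule prime_dvd_power[rotated])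
      then have "multiplicity q a \<ge> 1"
        using False q by (metis multiplicity_eq_zero_iff not_prime_unit less_one not_le)
      moreover have "multiplicity q n \<le> 1"
        using n q squarefree_factorial_semiring''[OF \<open>n \<noteq> 0\<close>] by auto
      ultimately show ?thesis by simp
    qed (simp add: not_dvd_imp_multiplicity_0)
  qed
qed simp

lemma power_commute: "(x ^ i) ^ j = (x ^ j) ^ i" for x :: "'a :: monoid_mult"
  by (simp only: power_mult[symmetric] mult.commute)

text \<open>Orthogonality of characters. If \<open>N\<close> does not divide \<open>t\<close>, the
  ratio of the geometric sum is not 1, because the \<open>N\<close> roots of unity are
  distinct.\<close>

lemma sum_powers_root_of_unity:
  assumes "N > 0"
  shows "(\<Sum>j<N. (cis (2 * pi / N) ^ t) ^ j) = (if N dvd t then of_nat N else 0)"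
proof -
  have pow: "cis (2 * pi / N) ^ s = cis (2 * pi * s / N)" for s
    by (simp add: DeMoivre mult_ac)
  have N: "cis (2 * pi / N) ^ N = 1" using assms by (simp add: pow)
  show ?thesis
  proof (cases "N dvd t")
    case True
    then have "cis (2 * pi / N) ^ t = 1" using N by (auto elim!: dvdE simp: power_mult)
    then show ?thesis using True by simp
  next
    case False
    have "inj_on (\<lambda>k. cis (2 * pi * real k / real N)) {..<N}"
      using Complex.bij_betw_roots_unity[OF assms] by (rule bij_betw_imp_inj_on)
    then have "cis (2 * pi * real (t mod N) / real N) \<noteq> cis (2 * pi * real 0 / real N)"
      using False assms by (metis inj_onD lessThan_iff mod_less_divisor dvd_eq_mod_eq_0)
    then have "cis (2 * pi / N) ^ (t mod N) \<noteq> 1" by (simp add: pow)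
    moreover have "cis (2 * pi / N) ^ t = cis (2 * pi / N) ^ (N * (t div N) + t mod N)" by simp
    then have "cis (2 * pi / N) ^ t = cis (2 * pi / N) ^ (t mod N)"
      unfolding power_add power_mult N by simp
    ultimately have ne: "cis (2 * pi / N) ^ t \<noteq> 1" by simp
    have "(cis (2 * pi / N) ^ t) ^ N = 1"
      using N by (metis power_mult mult.commute power_one)
    then show ?thesis using False by (simp add: geometric_sum[OF ne])
  qed
qed

text \<open>For i < N, the polynomial c_i in the decomposition of a(z) as the sum of z^i
  c_i(z^N).\<close>

definition section_poly :: "nat \<Rightarrow> nat \<Rightarrow> rat poly \<Rightarrow> rat poly" where
  "section_poly N i a = (\<Sum>m | m \<le> degree a \<and> m mod N = i. monom (coeff a m) (m div N))"

lemma evq_section_poly: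
  "z ^ i * evq (section_poly N i a) (z ^ N) =
    (\<Sum>m | m \<le> degree a \<and> m mod N = i. of_rat (coeff a m) * z ^ m)"
proof -
  have "evq (section_poly N i a) (z ^ N) =
      (\<Sum>m | m \<le> degree a \<and> m mod N = i. of_rat (coeff a m) * (z ^ N) ^ (m div N))"
    by (simp add: section_poly_def of_rat_poly.hom_sum poly_sum of_rat_hom.map_poly_hom_monom poly_monom)
  then have "z ^ i * evq (section_poly N i a) (z ^ N) =
      (\<Sum>m | m \<le> degree a \<and> m mod N = i. z ^ i * (of_rat (coeff a m) * (z ^ N) ^ (m div N)))"
    by (simp only: sum_distrib_left)
  also have "\<dots> = (\<Sum>m | m \<le> degree a \<and> m mod N = i. of_rat (coeff a m) * z ^ m)"
  proof (intro sum.cong refl)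
    fix m assume "m \<in> {m. m \<le> degree a \<and> m mod N = i}"
    then have "m = i + N * (m div N)" by (metis (mono_tags) mem_Collect_eq mod_mult_div_eq)
    then have "z ^ m = z ^ i * (z ^ N) ^ (m div N)" by (metis power_add power_mult)
    then show "z ^ i * (of_rat (coeff a m) * (z ^ N) ^ (m div N)) = of_rat (coeff a m) * z ^ m" by simp
  qed
  finally show ?thesis .
qed

lemma evq_eq_sum_sections:
  assumes "N > 0"
  shows "evq a z = (\<Sum>i<N. z ^ i * evq (section_poly N i a) (z ^ N))"
proof -
  have "evq a z = (\<Sum>m\<in>{..degree a}. of_rat (coeff a m) * z ^ m)" by (simp add: poly_altdef)
  also have "\<dots> = (\<Sum>i\<in>{..<N}. \<Sum>m | m \<in> {..degree a} \<and> m mod N = i. of_rat (coeff a m) * z ^ m)"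
    using assms by (intro sum.group[symmetric]) auto
  finally show ?thesis by (simp add: evq_section_poly)
qed

text \<open>Discrete Fourier inversion over the points \<zeta>^j z with \<zeta> =
  \<open>cis (2 * pi / N)\<close>. The exponent \<open>N - i\<close> stands for -i, and the factor
  \<open>N\<close> stays on the left so that no division spoils integrality on the right.\<close>

lemma section_poly_fourier:
  fixes N i :: nat
  assumes "i < N"
  shows "of_nat N * (z ^ i * evq (section_poly N i a) (z ^ N)) =
    (\<Sum>j<N. cis (2 * pi / N) ^ (j * (N - i)) * evq a (cis (2 * pi / N) ^ j * z))"
proof -
  let ?c = "cis (2 * pi / N)"
  have N: "N > 0" using assms by simp
  have dvd: "N dvd m + (N - i) \<longleftrightarrow> m mod N = i" for m
  proof -
    have "N dvd m + (N - i) \<longleftrightarrow> int N dvd int m - int i + int N"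
      using assms by (simp flip: int_dvd_int_iff add: of_nat_diff algebra_simps)
    also have "\<dots> \<longleftrightarrow> int N dvd int m - int i" by simp
    also have "\<dots> \<longleftrightarrow> int m mod int N = int i mod int N" by (simp add: mod_eq_dvd_iff)
    also have "\<dots> \<longleftrightarrow> m mod N = i" using assms by (simp flip: of_nat_mod)
    finally show ?thesis .
  qed
  have "(\<Sum>j<N. ?c ^ (j * (N - i)) * evq a (?c ^ j * z)) =
      (\<Sum>j<N. \<Sum>m\<le>degree a. of_rat (coeff a m) * z ^ m * (?c ^ (m + (N - i))) ^ j)"
  proof (rule sum.cong[OF refl])
    fix j
    have "?c ^ (j * (N - i)) * (of_rat (coeff a m) * (?c ^ j * z) ^ m)
        = of_rat (coeff a m) * z ^ m * (?c ^ (m + (N - i))) ^ j" for m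
    proof -
      have "(?c ^ (m + (N - i))) ^ j = ?c ^ (j * (N - i)) * (?c ^ j) ^ m"
        by (simp only: power_mult[symmetric] power_add[symmetric]) (simp add: algebra_simps)
      then show ?thesis by (simp add: power_mult_distrib)
    qed
    moreover have "?c ^ (j * (N - i)) * evq a (?c ^ j * z) =
        (\<Sum>m\<le>degree a. ?c ^ (j * (N - i)) * (of_rat (coeff a m) * (?c ^ j * z) ^ m))"
      by (simp add: poly_altdef sum_distrib_left)
    ultimately show "?c ^ (j * (N - i)) * evq a (?c ^ j * z) =
        (\<Sum>m\<le>degree a. of_rat (coeff a m) * z ^ m * (?c ^ (m + (N - i))) ^ j)"
      by (simp only:)
  qed
  also have "\<dots> = (\<Sum>m\<le>degree a. of_rat (coeff a m) * z ^ m * (\<Sum>j<N. (?c ^ (m + (N - i))) ^ j))"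
    by (subst sum.swap) (simp only: sum_distrib_left)
  also have "\<dots> = (\<Sum>m\<in>{..degree a}. if m mod N = i then of_nat N * (of_rat (coeff a m) * z ^ m) else 0)"
    unfolding sum_powers_root_of_unity[OF N] dvd by (intro sum.cong refl) simp
  also have "\<dots> = (\<Sum>m | m \<le> degree a \<and> m mod N = i. of_nat N * (of_rat (coeff a m) * z ^ m))"
    by (subst sum.inter_filter[symmetric]) auto
  also have "\<dots> = of_nat N * (z ^ i * evq (section_poly N i a) (z ^ N))"
    unfolding evq_section_poly by (simp add: sum_distrib_left)
  finally show ?thesis by simp
qed

section \<open>Denominators of integers of the larger field\<close>

lemma ev_monom: "ev (monom 1 N) z = z ^ N"
  by (simp add: poly_monom)

lemma multiple_in_int_adjoin:
  fixes f :: "int poly"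
  assumes f: "lead_coeff f = 1" "irreducible (map_poly of_int f :: rat poly)"
    and F: "irreducible (map_poly of_int (f \<circ>\<^sub>p monom 1 N) :: rat poly)"
    and N: "N > 0" and root: "ev (f \<circ>\<^sub>p monom 1 N) \<theta> = 0"
    and mono: "integer_ring (rat_adjoin (\<theta> ^ N)) = int_adjoin (\<theta> ^ N)"
    and sqf: "squarefree (poly f 0)"
    and x: "x \<in> integer_ring (rat_adjoin \<theta>)"
  shows "of_nat N * x \<in> int_adjoin \<theta>"
proof -
  let ?F = "f \<circ>\<^sub>p monom 1 N"
  have F1: "lead_coeff ?F = 1" using f(1) N by (subst lead_coeff_comp) (auto simp: degree_monom_eq)
  interpret F: monic_irreducible_root ?F \<theta> by unfold_locales fact+
  define \<eta> where "\<eta> = \<theta> ^ N"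
  have \<eta>: "ev f \<eta> = 0" using root by (simp only: ev_pcompose ev_monom \<eta>_def)
  interpret f: monic_irreducible_root f \<eta> by unfold_locales fact+
  have mono': "integer_ring (rat_adjoin \<eta>) = int_adjoin \<eta>" using mono unfolding \<eta>_def .
  from x obtain a where a: "x = evq a \<theta>" "algebraic_int (evq a \<theta>)" unfolding F.O_iff by blast
  define X where "X i = of_nat N * evq (section_poly N i a) \<eta>" for i
  have f0: "poly f 0 \<noteq> 0" using sqf by auto
  have "\<eta> \<noteq> 0"
  proof
    assume "\<eta> = 0"
    then have "of_int (poly f 0) = (0 :: complex)" using \<eta> by (simp add: poly_0_coeff_0)
    then show False using f0 by simp
  qed
  have O_\<eta>: "of_nat k * evq b \<eta> \<in> int_adjoin \<eta>" if "algebraic_int (of_nat k * evq b \<eta>)" for k b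
  proof -
    have "of_nat k * evq b \<eta> = evq (smult (of_nat k) b) \<eta>"
      by (simp add: of_rat_hom.map_poly_hom_smult)
    then show ?thesis using that unfolding mono'[symmetric] f.O_iff by metis
  qed
  have X: "X i \<in> int_adjoin \<theta>" if i: "i < N" for i
  proof -
    have int: "algebraic_int (\<theta> ^ i * X i)"
    proof -
      have c: "cis (2 * pi / N) ^ N = 1" using N by (simp add: DeMoivre)
      have ci: "algebraic_int (cis (2 * pi / N))"
      proof (rule algebraic_int_root)
        show "poly (monom 1 N) (cis (2 * pi / N)) = 1" unfolding poly_monom c by simp
        show "lead_coeff (monom (1 :: complex) N) = 1" by (simp add: degree_monom_eq)
        show "degree (monom (1 :: complex) N) > 0" using N by (simp add: degree_monom_eq)
        show "\<forall>i. coeff (monom (1 :: complex) N) i \<in> \<int>" by simp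
      qed (simp add: int_imp_algebraic_int)
      have "algebraic_int (evq a (cis (2 * pi / N) ^ j * \<theta>))" for j
      proof (rule F.algebraic_int_conjugate[OF a(2)])
        have "(cis (2 * pi / N) ^ j * \<theta>) ^ N = \<theta> ^ N"
          by (simp only: power_mult_distrib power_commute[of _ j N] c power_one mult_1)
        then show "ev ?F (cis (2 * pi / N) ^ j * \<theta>) = 0"
          using root by (simp only: ev_pcompose ev_monom)
      qed
      then have "algebraic_int (of_nat N * (\<theta> ^ i * evq (section_poly N i a) (\<theta> ^ N)))"
        unfolding section_poly_fourier[OF i]
        by (intro algebraic_int_sum algebraic_int_mult algebraic_int_power ci) auto
      then show ?thesis unfolding X_def \<eta>_def by (simp add: mult_ac)
    qed
    have "\<theta> ^ (N - i) * \<theta> ^ i = \<eta>" using i unfolding \<eta>_def by (simp flip: power_add)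
    \<comment> \<open>Integrality of \<open>X i\<close> itself is not yet known, but \<eta> times it
      is a power of \<theta> times the integer \<open>\<theta> ^ i * X i\<close>.\<close>
    then have \<eta>X: "\<eta> * X i = \<theta> ^ (N - i) * (\<theta> ^ i * X i)" by (simp flip: mult.assoc)
    have "algebraic_int (\<eta> * X i)" unfolding \<eta>X
      by (intro algebraic_int_mult algebraic_int_power int F.algebraic_int_root)
    moreover have "\<eta> * X i = of_nat N * evq (pCons 0 (section_poly N i a)) \<eta>"
      unfolding X_def by (simp add: of_rat_hom.map_poly_pCons_hom)
    ultimately have "\<eta> * X i \<in> int_adjoin \<eta>" using O_\<eta> by metis
    then obtain B where B: "\<eta> * X i = ev B \<eta>" unfolding f.R_iff by blast
    \<comment> \<open>The \<open>N\<close>-th power is a rational polynomial in \<eta>, so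
      monogenicity can be applied to it.\<close>
    have pw: "(\<theta> ^ i * X i) ^ N = \<eta> ^ i * X i ^ N"
      unfolding \<eta>_def by (simp only: power_mult_distrib power_commute[of _ i N])
    have "algebraic_int ((\<theta> ^ i * X i) ^ N)" by (rule algebraic_int_power[OF int])
    moreover have "(\<theta> ^ i * X i) ^ N =
        of_nat (N ^ N) * evq (monom 1 i * section_poly N i a ^ N) \<eta>"
      unfolding pw unfolding X_def power_mult_distrib
      by (simp add: of_rat_poly.hom_mult of_rat_poly.hom_power poly_monom of_rat_hom.map_poly_hom_monom)
    ultimately have "(\<theta> ^ i * X i) ^ N \<in> int_adjoin \<eta>" using O_\<eta> by metis
    then obtain C where C: "(\<theta> ^ i * X i) ^ N = ev C \<eta>" unfolding f.R_iff by blast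
    have "ev (B ^ N) \<eta> = (\<eta> * X i) ^ N" by (simp add: B ev_simps)
    also have "\<dots> = \<eta> ^ (N - i) * (\<theta> ^ i * X i) ^ N"
      unfolding pw unfolding power_mult_distrib mult.assoc[symmetric] power_add[symmetric]
      using i by simp
    also have "\<dots> = ev (monom 1 (N - i) * C) \<eta>" unfolding C by (simp add: ev_simps poly_monom)
    finally obtain E where "B ^ N = monom 1 (N - i) * C + f * E" by (rule f.ev_eqE)
    \<comment> \<open>Evaluation at 0 is reduction modulo \<eta>. Since i < N, the monomial
      contributes 0.\<close>
    then have "poly (B ^ N) 0 = poly (monom 1 (N - i) * C + f * E) 0" by simp
    then have "poly B 0 ^ N = poly f 0 * poly E 0" using i by (simp add: poly_monom power_0_left)
    then have "poly f 0 dvd poly B 0 ^ N" by simp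
    then have "poly f 0 dvd poly B 0" by (rule squarefree_dvd_power[OF sqf])
    then obtain e where "poly B 0 = poly f 0 * e" by (elim dvdE)
    \<comment> \<open>Subtracting a multiple of \<open>f\<close> keeps the value at \<eta> and
      removes the constant term, so that \<eta> can be cancelled.\<close>
    then have "poly (B - f * [:e:]) 0 = 0" by simp
    then have "[:0, 1:] dvd B - f * [:e:]" by (simp only: poly_eq_0_iff_dvd minus_zero)
    then obtain B' where B': "B - f * [:e:] = [:0, 1:] * B'" by (elim dvdE)
    have "ev B \<eta> = ev (B - f * [:e:]) \<eta>" using \<eta>
      by (simp add: ev_simps of_int_hom.map_poly_hom_smult)
    also have "\<dots> = \<eta> * ev B' \<eta>" unfolding B' by (simp add: ev_simps)
    finally have "X i = ev B' \<eta>" using B \<open>\<eta> \<noteq> 0\<close> by simp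
    also have "\<dots> = ev (B' \<circ>\<^sub>p monom 1 N) \<theta>" by (simp only: ev_pcompose ev_monom \<eta>_def)
    finally show ?thesis using F.ev_in_R by metis
  qed
  have "of_nat N * x = (\<Sum>i<N. \<theta> ^ i * X i)"
    unfolding a(1) evq_eq_sum_sections[OF N, of a \<theta>] X_def \<eta>_def by (simp add: sum_distrib_left mult_ac)
  also have "\<dots> \<in> int_adjoin \<theta>"
  proof (intro F.R_sum F.R_mult X)
    show "\<theta> ^ i \<in> int_adjoin \<theta>" for i using F.ev_in_R[of "monom 1 i"] by (simp only: ev_monom)
  qed simp
  finally show ?thesis .
qed

text \<open>Index 1 leaves only the coset of 0, and \<open>poly_index\<close> carries this over to
  the given root.\<close>

lemma monogenic_integer_ring:
  assumes "monogenic f" "ev f \<eta> = 0"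
  shows "integer_ring (rat_adjoin \<eta>) = int_adjoin \<eta>"
proof -
  interpret monic_irreducible_root f \<eta>
    using assms unfolding monogenic_def by unfold_locales auto
  have "card ((\<lambda>\<alpha>. (+) \<alpha> ` R) ` \<O>) = 1"
    using assms(1) poly_index unfolding monogenic_def additive_index_def by simp
  then obtain S where S: "(\<lambda>\<alpha>. (+) \<alpha> ` R) ` \<O> = {S}" by (rule card_1_singletonE)
  have 0: "0 \<in> R" using ev_in_R[of 0] by simp
  have "x \<in> R" if x: "x \<in> \<O>" for x
  proof -
    have "0 \<in> \<O>" using 0 R_subset_O by blast
    then have "(+) 0 ` R \<in> {S}" unfolding S[symmetric] by (rule imageI)
    moreover have "(+) x ` R \<in> {S}" unfolding S[symmetric] using x by (rule imageI)
    ultimately have "(+) x ` R = (+) 0 ` R" by (simp only: singleton_iff)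
    then have "x + 0 \<in> (+) 0 ` R" using 0 by blast
    then show ?thesis by simp
  qed
  then show ?thesis using R_subset_O by blast
qed

text \<open>The integrality of (f(x^p) - f(x)^p)/p is expressed by the existence of
  \<open>h\<close>, whose image over the rationals is this quotient.\<close>

theorem theorem1p6:
  fixes u p :: nat and f :: "int poly"
  assumes "u > 0"
    and "prime p"
    and "lead_coeff f = 1"
    and "irreducible (map_poly of_int (f \<circ>\<^sub>p monom 1 (p ^ u)) :: rat poly)"
  shows "(monogenic f \<and> squarefree (poly f 0) \<longrightarrow>
            (\<exists>s :: nat. poly_index (f \<circ>\<^sub>p monom 1 (p ^ u)) = p ^ s)) \<and>
         (\<exists>h :: int poly.
            map_poly of_int h =
              smult (1 / of_nat p) (map_poly of_int (f \<circ>\<^sub>p monom 1 p - f ^ p) :: rat poly) \<and>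
            (\<not> p dvd poly_index (f \<circ>\<^sub>p monom 1 (p ^ u)) \<longleftrightarrow>
              poly_mod.coprime_m (int p) h f))"
proof -
  let ?N = "p ^ u"
  let ?F = "f \<circ>\<^sub>p monom 1 ?N"
  have p1: "p > 1" using assms(2) by (rule prime_gt_1_nat)
  then have N: "?N > 0" by simp
  have F1: "lead_coeff ?F = 1" using assms(3) N by (subst lead_coeff_comp) (auto simp: degree_monom_eq)
  have "degree (map_poly of_int ?F :: rat poly) \<noteq> 0"
  proof
    assume "degree (map_poly of_int ?F :: rat poly) = 0"
    then have "?F = 1" using F1 monic_degree_0[of ?F] by (simp add: degree_of_int_poly_rat)
    then show False using assms(4) by simp
  qed
  then have "\<not> constant (poly (map_poly of_int ?F :: complex poly))"
    by (simp add: constant_degree degree_of_int_poly_rat)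
  then obtain \<theta> :: complex where root: "ev ?F \<theta> = 0"
    using fundamental_theorem_of_algebra by blast
  interpret F: monic_irreducible_root ?F \<theta> by unfold_locales fact+
  have part1: "\<exists>s. poly_index ?F = p ^ s" if mono: "monogenic f" and sqf: "squarefree (poly f 0)"
  proof -
    have f: "irreducible (map_poly of_int f :: rat poly)" using mono unfolding monogenic_def by blast
    have "ev f (\<theta> ^ ?N) = 0" using root by (simp only: ev_pcompose ev_monom)
    from multiple_in_int_adjoin[OF assms(3) f assms(4) N root monogenic_integer_ring[OF mono this] sqf]
    show ?thesis unfolding F.poly_index
      by (rule additive_subgroup_pair.index_prime_power[OF F.additive_subgroup_pair assms(2)])
  qed
  obtain h where h: "f \<circ>\<^sub>p monom 1 p = f ^ p + of_nat p * h"
    using pcompose_monom_prime[OF assms(2)] by blast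
  obtain v where v: "u = Suc v" using assms(1) by (metis gr0_implies_Suc)
  obtain c where "?F = f ^ ?N + of_nat p * (h ^ (p ^ v) + of_nat p * c)"
    using pcompose_monom_prime_power[OF assms(2) h] unfolding v by blast
  then have F: "?F = f ^ ?N + of_int (int p) * (h ^ (p ^ v) + of_int (int p) * c)" by simp
  have p': "prime (int p)" using assms(2) by simp
  have "?N \<ge> 2 ^ 1" using p1 assms(1) by (intro order.trans[OF power_increasing power_mono]) auto
  then have N2: "?N \<ge> 2" by simp
  \<comment> \<open>The criterion speaks of \<open>h ^ (p ^ v)\<close> plus a multiple of
    \<open>p\<close>; neither that multiple nor the positive exponent affects comaximality with
    \<open>f\<close>.\<close>
  have part2: "\<not> p dvd poly_index ?F \<longleftrightarrow> poly_mod.coprime_m (int p) h f"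
    unfolding F.dedekind_criterion[OF assms(2,3) N2 F] coprime_m_iff_comaximal[OF p' assms(3)]
      comaximal_mod_cong[OF refl]
    using p1 by (intro comaximal_mod_power) simp
  have "map_poly of_int h =
      smult (1 / of_nat p) (map_poly of_int (f \<circ>\<^sub>p monom 1 p - f ^ p) :: rat poly)"
    using p1 by (simp add: h of_int_poly_hom.hom_mult of_nat_poly of_int_hom.map_poly_hom_smult)
  then show ?thesis using part1 part2 by blast
qed

end
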